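(* Let $\mathcal H=L^2(\mathbb S^n)$ and let $V$ be a Hilbert space. Assume that $F:L^2(\mathbb S^n)\to L^2(\mathbb S^n)$ and $\mathfrak C:V\to L^2(\mathbb S^n)$ are both globally Lipschitz and that $\mathfrak C(0)=0$. Let $U$ be a compact subset of $V$, let $q>1$, and for $T>0$ let $\mathcal U_{ad}=\{f\in L^q(0,T;V):f(s)\in U\text{ for a.e. }s\in[0,T]\}$. Then, for any $T>0$ and any $(x,u)\in L^2(\mathbb S^n)\times\mathcal U_{ad}$, the problem $$\frac{dy}{dt}=\Delta_{\mathfrak g}y+F(y)+\mathfrak C(u(t)),\quad t\in(0,T],\qquad y(0)=x,$$ admits a unique mild solution $y(\cdot;x,u)\in C([0,T],\mathcal H)$, and its Galerkin approximation $$\frac{dy_N}{dt}=L_Ny_N+\Pi_NF(y_N)+\Pi_N\mathfrak C(u(t)),\quad t\in[0,T],\qquad y_N(0)=\Pi_Nx,$$ admits a unique solution $y_N(\cdot;\Pi_Nx,u)\in C([0,T],\mathcal H_N)$ for each $N\ge1$. Moreover, for any $T>0$ and $x\in L^2(\mathbb S^n)$, $$\lim_{N\to\infty}\ \sup_{u\in\mathcal U_{ad}}\ \sup_{t\in[0,T]}\|y_N(t;\Pi_Nx,u)-y(t;x,u)\|_{\mathcal H}=0.$$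
   Context: $\mathbb S^n=\{x\in\mathbb R^{n+1}:|x|=1\}$ is equipped with its canonical (round) Riemannian metric $\mathfrak g$, $\Delta_{\mathfrak g}=\mathrm{div}_{\mathfrak g}\circ\nabla_{\mathfrak g}$ is the Laplace–Beltrami operator, and $\mathcal L_{\mathfrak g}:=-\Delta_{\mathfrak g}$ with domain $\mathcal D(\mathcal L_{\mathfrak g})=\{u\in L^2(\mathbb S^n):\nabla_{\mathfrak g}u\in\vec L^2(\mathbb S^n),\ \Delta_{\mathfrak g}u\in L^2(\mathbb S^n)\}$, where $\vec L^2(\mathbb S^n)$ denotes square-integrable vector fields. It is known that $\mathcal L_{\mathfrak g}$ is self-adjoint with discrete spectrum, consisting of an increasing sequence of non-negative eigenvalues $\lambda_k\to+\infty$ (counted with multiplicity), with an orthonormal basis $\{e_k\}_{k\ge1}$ of $L^2(\mathbb S^n)$ of eigenfunctions ($\mathcal L_{\mathfrak g}e_k=\lambda_ke_k$), and that $-\mathcal L_{\mathfrak g}$ generates a $C_0$-semigroup of contractions $(P(t))_{t\ge0}$ on $L^2(\mathbb S^n)$. A mild solution is $y\in C([0,T],\mathcal H)$ with $y(t)=P(t)x+\int_0^tP(t-s)F(y(s))\,ds+\int_0^tP(t-s)\mathfrak C(u(s))\,ds$ for $t\in[0,T]$. $\mathcal H_N:=\mathrm{span}\{e_k:k=1,\dots,N\}$, $\Pi_N$ is the orthogonal projector of $\mathcal H$ onto $\mathcal H_N$, and $L_N:=\Pi_N\Delta_{\mathfrak g}\Pi_N:\mathcal H\to\mathcal H_N$.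 The Galerkin approximation is understood through the variation-of-constants formula $y_N(t)=e^{L_Nt}\Pi_Nx+\int_0^te^{L_N(t-s)}\Pi_NF(y_N(s))\,ds+\int_0^te^{L_N(t-s)}\Pi_N\mathfrak C(u(s))\,ds$. *)

theory Defs
  imports "HOL-Analysis.Analysis"
begin

section \<open>The round sphere and its Hilbert space of square-integrable functions\<close>

text \<open>
  Throughout, \<open>\<real>\<^sup>n\<^sup>+\<^sup>1\<close> is a Euclidean space \<open>'a\<close> with \<open>DIM('a) = n + 1\<close>, and \<open>\<bbbS>\<^sup>n\<close> is
  \<open>sphere 0 1 :: 'a set\<close>. The Riemannian volume of the round metric is the cone measure
  \<open>\<sigma>(A) = DIM('a) * |{r x | 0 < r < 1, x \<in> A}|\<close>.
\<close>

definition sphere_measure :: "'a::euclidean_space measure" where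
  "sphere_measure =
     scale_measure (ennreal (real DIM('a)))
       (distr (restrict_space lborel (ball 0 1 - {0})) (restrict_space borel (sphere 0 1))
          (\<lambda>x. x /\<^sub>R norm x))"

lemma space_sphere_measure [simp]: "space sphere_measure = sphere 0 1"
  by (simp add: sphere_measure_def space_scale_measure space_restrict_space)

lemma sets_sphere_measure [measurable_cong]:
  "sets sphere_measure = sets (restrict_space borel (sphere 0 1))"
  by (simp add: sphere_measure_def)

lemma measurable_sphere_projection:
  "(\<lambda>x::'a::euclidean_space. x /\<^sub>R norm x)
     \<in> measurable (restrict_space lborel (ball 0 1 - {0})) (restrict_space borel (sphere 0 1))"
  by (intro measurable_restrict_space2 measurable_restrict_space1)
     (auto simp: space_restrict_space)

lemma emeasure_sphere_measure:
  fixes A :: "'a::euclidean_space set"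
  assumes "A \<in> sets sphere_measure"
  shows "emeasure sphere_measure A
       = ennreal (real DIM('a)) * emeasure lborel {x \<in> ball 0 1 - {0}. x /\<^sub>R norm x \<in> A}"
proof -
  have "emeasure sphere_measure A = ennreal (real DIM('a)) *
      emeasure (restrict_space lborel (ball 0 1 - {0}))
        ((\<lambda>x. x /\<^sub>R norm x) -` A \<inter> space (restrict_space lborel (ball 0 1 - {0})))"
    using assms unfolding sphere_measure_def
    by (simp add: emeasure_distr[OF measurable_sphere_projection])
  also have "(\<lambda>x. x /\<^sub>R norm x) -` A \<inter> space (restrict_space lborel (ball 0 1 - {0}))
      = {x \<in> ball 0 1 - {0}. x /\<^sub>R norm x \<in> A}"
    by (auto simp: space_restrict_space)
  also have "emeasure (restrict_space lborel (ball 0 1 - {0})) \<dots> = emeasure lborel \<dots>"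
    by (subst emeasure_restrict_space) auto
  finally show ?thesis .
qed

lemma finite_measure_sphere_measure: "finite_measure (sphere_measure :: 'a::euclidean_space measure)"
proof
  have "space sphere_measure \<in> sets (sphere_measure :: 'a measure)"
    by (rule sets.top)
  moreover have "emeasure lborel {x :: 'a. x \<in> ball 0 1 - {0} \<and> x /\<^sub>R norm x \<in> sphere 0 1} < \<infinity>"
    by (intro emeasure_bounded_finite bounded_subset[OF bounded_ball[of 0 1]]) auto
  ultimately show "emeasure sphere_measure (space sphere_measure :: 'a set) \<noteq> \<infinity>"
    by (simp add: emeasure_sphere_measure ennreal_mult_eq_top_iff del: mem_sphere_0)
qed

interpretation sphere: finite_measure "sphere_measure :: 'a::euclidean_space measure"
  by (rule finite_measure_sphere_measure)

definition sq_integrable :: "('a::euclidean_space \<Rightarrow> 'b::euclidean_space) \<Rightarrow> bool" where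
  "sq_integrable f \<longleftrightarrow>
     f \<in> borel_measurable sphere_measure \<and> integrable sphere_measure (\<lambda>x. (norm (f x))\<^sup>2)"

lemma sq_integrable_measurable: "sq_integrable f \<Longrightarrow> f \<in> borel_measurable sphere_measure"
  by (simp add: sq_integrable_def)

lemma sq_integrable_sq: "sq_integrable (f :: _ \<Rightarrow> real) \<Longrightarrow> integrable sphere_measure (\<lambda>x. (f x)\<^sup>2)"
  by (simp add: sq_integrable_def)

lemma sq_integrable_mult:
  fixes f g :: "'a::euclidean_space \<Rightarrow> real"
  assumes "sq_integrable f" "sq_integrable g"
  shows "integrable sphere_measure (\<lambda>x. f x * g x)"
proof (rule Bochner_Integration.integrable_bound)
  show "integrable sphere_measure (\<lambda>x. (f x)\<^sup>2 + (g x)\<^sup>2)"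
    using assms by (auto simp: sq_integrable_sq)
  show "(\<lambda>x. f x * g x) \<in> borel_measurable sphere_measure"
    using assms by (intro borel_measurable_times sq_integrable_measurable)
  have "\<bar>a * b\<bar> \<le> a\<^sup>2 + b\<^sup>2" for a b :: real
    using sum_squares_bound[of a b] sum_squares_bound[of a "- b"] zero_le_power2[of a]
      zero_le_power2[of b] by (simp add: abs_le_iff)
  then show "AE x in sphere_measure. norm (f x * g x) \<le> norm ((f x)\<^sup>2 + (g x)\<^sup>2)"
    by (auto intro!: AE_I2)
qed

lemma sq_integrable_add:
  fixes f g :: "'a::euclidean_space \<Rightarrow> real"
  assumes "sq_integrable f" "sq_integrable g"
  shows "sq_integrable (\<lambda>x. f x + g x)"
  using assms sq_integrable_mult[OF assms]
  by (auto simp: sq_integrable_def power2_sum mult.assoc)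

lemma sq_integrable_scale:
  fixes f :: "'a::euclidean_space \<Rightarrow> real"
  assumes "sq_integrable f"
  shows "sq_integrable (\<lambda>x. c * f x)"
  using assms by (auto simp: sq_integrable_def power_mult_distrib abs_mult)

lemma sq_integrable_minus:
  fixes f :: "'a::euclidean_space \<Rightarrow> real"
  assumes "sq_integrable f"
  shows "sq_integrable (\<lambda>x. - f x)"
  using assms by (auto simp: sq_integrable_def)

lemma sq_integrable_diff:
  fixes f g :: "'a::euclidean_space \<Rightarrow> real"
  assumes "sq_integrable f" "sq_integrable g"
  shows "sq_integrable (\<lambda>x. f x - g x)"
  using sq_integrable_add[OF assms(1) sq_integrable_minus[OF assms(2)]] by simp

lemma sq_integrable_zero: "sq_integrable (\<lambda>x. 0 :: real)"
  by (simp add: sq_integrable_def)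

definition l2_rel :: "('a::euclidean_space \<Rightarrow> real) \<Rightarrow> ('a \<Rightarrow> real) \<Rightarrow> bool" where
  "l2_rel f g \<longleftrightarrow>
     sq_integrable f \<and> sq_integrable g \<and> (AE x in sphere_measure. f x = g x)"

quotient_type (overloaded) 'a sphere_L2 = "'a::euclidean_space \<Rightarrow> real" / partial: l2_rel
proof (rule part_equivpI)
  show "\<exists>f :: 'a \<Rightarrow> real. l2_rel f f"
    by (rule exI[of _ "\<lambda>x. 0"]) (simp add: l2_rel_def sq_integrable_zero)
  show "symp (l2_rel :: ('a \<Rightarrow> real) \<Rightarrow> _)"
    unfolding symp_def l2_rel_def using AE_symmetric by blast
  show "transp (l2_rel :: ('a \<Rightarrow> real) \<Rightarrow> _)"
  proof (rule transpI)
    fix f g h :: "'a \<Rightarrow> real"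
    assume "l2_rel f g" "l2_rel g h"
    moreover from this have "AE x in sphere_measure. f x = g x" "AE x in sphere_measure. g x = h x"
      by (auto simp: l2_rel_def)
    then have "AE x in sphere_measure. f x = h x"
      by eventually_elim simp
    ultimately show "l2_rel f h"
      by (auto simp: l2_rel_def)
  qed
qed

instantiation sphere_L2 :: (euclidean_space) real_vector
begin

lift_definition zero_sphere_L2 :: "'a sphere_L2" is "\<lambda>_. 0"
  by (simp add: l2_rel_def sq_integrable_zero)

lift_definition plus_sphere_L2 :: "'a sphere_L2 \<Rightarrow> 'a sphere_L2 \<Rightarrow> 'a sphere_L2"
  is "\<lambda>f g x. f x + g x"
  by (auto simp: l2_rel_def sq_integrable_add)

lift_definition uminus_sphere_L2 :: "'a sphere_L2 \<Rightarrow> 'a sphere_L2" is "\<lambda>f x. - f x"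
  by (auto simp: l2_rel_def sq_integrable_minus)

lift_definition minus_sphere_L2 :: "'a sphere_L2 \<Rightarrow> 'a sphere_L2 \<Rightarrow> 'a sphere_L2"
  is "\<lambda>f g x. f x - g x"
  by (auto simp: l2_rel_def sq_integrable_diff)

lift_definition scaleR_sphere_L2 :: "real \<Rightarrow> 'a sphere_L2 \<Rightarrow> 'a sphere_L2" is "\<lambda>c f x. c * f x"
  by (auto simp: l2_rel_def sq_integrable_scale)

instance
proof
  fix u v w :: "'a sphere_L2" and r s :: real
  show "u + v + w = u + (v + w)"
    by transfer (auto simp: l2_rel_def sq_integrable_add algebra_simps)
  show "u + v = v + u"
    by transfer (auto simp: l2_rel_def sq_integrable_add algebra_simps)
  show "0 + u = u"
    by transfer (auto simp: l2_rel_def)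
  show "- u + u = 0"
    by transfer (auto simp: l2_rel_def sq_integrable_zero)
  show "u - v = u + - v"
    by transfer (auto simp: l2_rel_def sq_integrable_diff)
  show "r *\<^sub>R (u + v) = r *\<^sub>R u + r *\<^sub>R v"
    by transfer (auto simp: l2_rel_def sq_integrable_add sq_integrable_scale algebra_simps
                  intro!: sq_integrable_add sq_integrable_scale)
  show "(r + s) *\<^sub>R u = r *\<^sub>R u + s *\<^sub>R u"
    by transfer (auto simp: l2_rel_def algebra_simps intro!: sq_integrable_add sq_integrable_scale)
  show "r *\<^sub>R s *\<^sub>R u = (r * s) *\<^sub>R u"
    by transfer (auto simp: l2_rel_def algebra_simps intro!: sq_integrable_scale)
  show "1 *\<^sub>R u = u"
    by transfer (auto simp: l2_rel_def)
qed

end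

instantiation sphere_L2 :: (euclidean_space) real_inner
begin

lift_definition inner_sphere_L2 :: "'a sphere_L2 \<Rightarrow> 'a sphere_L2 \<Rightarrow> real"
  is "\<lambda>f g. LINT x|sphere_measure. f x * g x"
proof -
  fix f f' g g' :: "'a \<Rightarrow> real"
  assume *: "l2_rel f f'" "l2_rel g g'"
  then have "AE x in sphere_measure. f x = f' x" "AE x in sphere_measure. g x = g' x"
    by (auto simp: l2_rel_def)
  then have "AE x in sphere_measure. f x * g x = f' x * g' x"
    by eventually_elim simp
  then show "(LINT x|sphere_measure. f x * g x) = (LINT x|sphere_measure. f' x * g' x)"
    using * by (intro integral_cong_AE) (auto simp: l2_rel_def dest!: sq_integrable_measurable)
qed

definition norm_sphere_L2 :: "'a sphere_L2 \<Rightarrow> real" where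
  "norm_sphere_L2 u = sqrt (inner u u)"

definition sgn_sphere_L2 :: "'a sphere_L2 \<Rightarrow> 'a sphere_L2" where
  "sgn_sphere_L2 u = u /\<^sub>R norm u"

definition dist_sphere_L2 :: "'a sphere_L2 \<Rightarrow> 'a sphere_L2 \<Rightarrow> real" where
  "dist_sphere_L2 u v = norm (u - v)"

definition uniformity_sphere_L2 :: "('a sphere_L2 \<times> 'a sphere_L2) filter" where
  "uniformity_sphere_L2 = (INF e\<in>{0 <..}. principal {(x, y). dist x y < e})"

definition open_sphere_L2 :: "'a sphere_L2 set \<Rightarrow> bool" where
  "open_sphere_L2 S \<longleftrightarrow>
     (\<forall>x\<in>S. \<forall>\<^sub>F (x', y) in uniformity. x' = x \<longrightarrow> y \<in> S)"

instance
proof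
  fix u v w :: "'a sphere_L2" and r :: real and S :: "'a sphere_L2 set"
  show "inner u v = inner v u"
    by transfer (simp add: mult.commute)
  show "inner (u + v) w = inner u w + inner v w"
    by transfer (simp add: l2_rel_def distrib_right sq_integrable_mult)
  show "inner (r *\<^sub>R u) v = r * inner u v"
    by transfer (simp add: mult.assoc)
  show "0 \<le> inner u u"
    by transfer simp
  show "inner u u = 0 \<longleftrightarrow> u = 0"
  proof transfer
    fix f :: "'a \<Rightarrow> real"
    assume "l2_rel f f"
    then have f: "sq_integrable f" by (simp add: l2_rel_def)
    have "((LINT x|sphere_measure. f x * f x) = 0) = (AE x in sphere_measure. f x * f x = 0)"
      by (rule integral_nonneg_eq_0_iff_AE) (auto intro: sq_integrable_mult f)
    then show "((LINT x|sphere_measure. f x * f x) = 0) = l2_rel f (\<lambda>_. 0)"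
      using f by (simp add: l2_rel_def sq_integrable_zero)
  qed
  show "norm u = sqrt (inner u u)"
    by (rule norm_sphere_L2_def)
qed (rule sgn_sphere_L2_def dist_sphere_L2_def uniformity_sphere_L2_def open_sphere_L2_def)+

end

lemma sq_integrable_rep: "sq_integrable (rep_sphere_L2 u)"
  using Quotient3_rep_reflp[OF Quotient3_sphere_L2] by (auto simp: l2_rel_def)

lemma abs_rep_sphere_L2: "abs_sphere_L2 (rep_sphere_L2 u) = u"
  by (rule Quotient3_abs_rep[OF Quotient3_sphere_L2])

lemma abs_sphere_L2_add:
  "sq_integrable f \<Longrightarrow> sq_integrable g \<Longrightarrow>
     abs_sphere_L2 f + abs_sphere_L2 g = abs_sphere_L2 (\<lambda>x. f x + g x)"
  by (rule plus_sphere_L2.abs_eq) (auto simp: l2_rel_def)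

lemma abs_sphere_L2_diff:
  "sq_integrable f \<Longrightarrow> sq_integrable g \<Longrightarrow>
     abs_sphere_L2 f - abs_sphere_L2 g = abs_sphere_L2 (\<lambda>x. f x - g x)"
  by (rule minus_sphere_L2.abs_eq) (auto simp: l2_rel_def)

lemma abs_sphere_L2_scale:
  "sq_integrable f \<Longrightarrow> c *\<^sub>R abs_sphere_L2 f = abs_sphere_L2 (\<lambda>x. c * f x)"
  by (rule scaleR_sphere_L2.abs_eq) (auto simp: l2_rel_def)

lemma inner_abs_sphere_L2:
  "sq_integrable f \<Longrightarrow> sq_integrable g \<Longrightarrow>
     inner (abs_sphere_L2 f) (abs_sphere_L2 g) = (LINT x|sphere_measure. f x * g x)"
  by (rule inner_sphere_L2.abs_eq) (auto simp: l2_rel_def)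

lemma norm_abs_sphere_L2:
  assumes "sq_integrable f"
  shows "ennreal ((norm (abs_sphere_L2 f))\<^sup>2) = (\<integral>\<^sup>+x. ennreal ((f x)\<^sup>2) \<partial>sphere_measure)"
proof -
  have "(norm (abs_sphere_L2 f))\<^sup>2 = (LINT x|sphere_measure. (f x)\<^sup>2)"
    unfolding power2_norm_eq_inner using assms by (simp add: inner_abs_sphere_L2 power2_eq_square)
  then show ?thesis
    using sq_integrable_sq[OF assms] by (simp add: nn_integral_eq_integral)
qed

lemma sq_integrable_bounded:
  fixes f :: "'a::euclidean_space \<Rightarrow> real"
  assumes "f \<in> borel_measurable sphere_measure" "\<And>x. \<bar>f x\<bar> \<le> c"
  shows "sq_integrable f"
proof -
  have "(f x)\<^sup>2 \<le> c\<^sup>2" for x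
    using power_mono[OF assms(2)[of x], of 2] by simp
  then have "integrable sphere_measure (\<lambda>x. (f x)\<^sup>2)"
    using assms(1) by (intro sphere.integrable_const_bound[where B = "c\<^sup>2"]) auto
  with assms(1) show ?thesis by (simp add: sq_integrable_def)
qed

lemma sq_integrable_one: "sq_integrable (\<lambda>_. 1 :: real)"
  by (rule sq_integrable_bounded[where c = 1]) auto

instance sphere_L2 :: (euclidean_space) complete_space
proof
  fix X :: "nat \<Rightarrow> 'a sphere_L2"
  assume "Cauchy X"
  then have "\<forall>k. \<exists>N. \<forall>m\<ge>N. \<forall>n\<ge>N. norm (X m - X n) < (1/2) ^ k"
    unfolding Cauchy_def dist_norm by (intro allI) (auto intro: zero_less_power)
  then obtain N where N: "\<And>k m n. m \<ge> N k \<Longrightarrow> n \<ge> N k \<Longrightarrow> norm (X m - X n) < (1/2) ^ k"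
    by metis
  define r where "r k = (\<Sum>i\<le>k. N i)" for k
  have r: "N k \<le> r l" if "k \<le> l" for k l
    unfolding r_def using that by (intro member_le_sum) auto
  define f where "f n = rep_sphere_L2 (X n)" for n
  define g where "g k = f (r k)" for k
  have f: "sq_integrable (f n)" "abs_sphere_L2 (f n) = X n" for n
    by (auto simp: f_def sq_integrable_rep abs_rep_sphere_L2)
  have [measurable]: "f n \<in> borel_measurable sphere_measure" for n
    by (rule sq_integrable_measurable[OF f(1)])
  have [measurable]: "g n \<in> borel_measurable sphere_measure" for n
    by (simp add: g_def)
  define c where "c = norm (abs_sphere_L2 (\<lambda>_. 1) :: 'a sphere_L2)"
  note one = sq_integrable_one[where 'a = 'a]
  have L1: "(\<integral>\<^sup>+x. ennreal \<bar>g (Suc k) x - g k x\<bar> \<partial>sphere_measure) \<le> ennreal (c * (1/2) ^ k)" for k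
  proof -
    let ?h = "\<lambda>x. g (Suc k) x - g k x"
    have h: "sq_integrable ?h"
      using f by (auto simp: g_def intro: sq_integrable_diff)
    have ah: "sq_integrable (\<lambda>x. \<bar>?h x\<bar>)"
      using h by (simp add: sq_integrable_def)
    have "ennreal ((norm (abs_sphere_L2 (\<lambda>x. \<bar>?h x\<bar>)))\<^sup>2) = ennreal ((norm (abs_sphere_L2 ?h))\<^sup>2)"
      using h ah by (simp add: norm_abs_sphere_L2)
    then have "norm (abs_sphere_L2 (\<lambda>x. \<bar>?h x\<bar>)) = norm (abs_sphere_L2 ?h)"
      by simp
    also have "abs_sphere_L2 ?h = X (r (Suc k)) - X (r k)"
      using f by (simp add: g_def flip: abs_sphere_L2_diff)
    also have "norm \<dots> \<le> (1/2) ^ k"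
      using N[OF r r, of k "Suc k" k] by simp
    finally have nh: "norm (abs_sphere_L2 (\<lambda>x. \<bar>?h x\<bar>)) \<le> (1/2) ^ k" .
    have "(LINT x|sphere_measure. \<bar>?h x\<bar>) = inner (abs_sphere_L2 (\<lambda>x. \<bar>?h x\<bar>)) (abs_sphere_L2 (\<lambda>_. 1))"
      using ah one by (simp add: inner_abs_sphere_L2)
    also have "\<dots> \<le> norm (abs_sphere_L2 (\<lambda>x. \<bar>?h x\<bar>)) * c"
      unfolding c_def by (rule norm_cauchy_schwarz)
    also have "\<dots> \<le> (1/2) ^ k * c"
      by (intro mult_right_mono nh) (simp add: c_def)
    finally have le: "(LINT x|sphere_measure. \<bar>?h x\<bar>) \<le> c * (1/2) ^ k"
      by (simp add: mult.commute)
    have "integrable sphere_measure (\<lambda>x. \<bar>?h x\<bar>)"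
      using sq_integrable_mult[OF ah one] by simp
    with le show ?thesis
      by (simp add: nn_integral_eq_integral ennreal_leI)
  qed
  have "(\<integral>\<^sup>+x. (\<Sum>k. ennreal \<bar>g (Suc k) x - g k x\<bar>) \<partial>sphere_measure)
      = (\<Sum>k. \<integral>\<^sup>+x. ennreal \<bar>g (Suc k) x - g k x\<bar> \<partial>sphere_measure)"
    by (rule nn_integral_suminf) measurable
  also have "\<dots> \<le> (\<Sum>k. ennreal (c * (1/2) ^ k))"
    by (intro suminf_le L1) auto
  also have "\<dots> = ennreal (\<Sum>k. c * (1/2) ^ k)"
    by (intro suminf_ennreal2 summable_mult summable_geometric) (auto simp: c_def)
  also have "\<dots> < \<infinity>" by simp
  finally have "AE x in sphere_measure. (\<Sum>k. ennreal \<bar>g (Suc k) x - g k x\<bar>) \<noteq> \<infinity>"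
    by (intro nn_integral_noteq_infinite) auto
  then have conv: "AE x in sphere_measure. convergent (\<lambda>k. g k x)"
  proof eventually_elim
    case (elim x)
    then have "summable (\<lambda>k. \<bar>g (Suc k) x - g k x\<bar>)"
      by (intro summable_suminf_not_top) auto
    then have "summable (\<lambda>k. g (Suc k) x - g k x)"
      by (rule summable_rabs_cancel)
    then have "(\<lambda>n. \<Sum>k<n. g (Suc k) x - g k x) \<longlonglongrightarrow> (\<Sum>k. g (Suc k) x - g k x)"
      by (rule summable_LIMSEQ)
    then have "(\<lambda>n. g n x - g 0 x) \<longlonglongrightarrow> (\<Sum>k. g (Suc k) x - g k x)"
      by (simp only: sum_lessThan_telescope[of "\<lambda>k. g k x"])
    from tendsto_add[OF this tendsto_const[of "g 0 x"]]
    have "(\<lambda>n. g n x) \<longlonglongrightarrow> (\<Sum>k. g (Suc k) x - g k x) + g 0 x"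
      by simp
    then show ?case by (auto simp: convergent_def)
  qed
  define L where "L x = lim (\<lambda>k. g k x)" for x
  have [measurable]: "L \<in> borel_measurable sphere_measure"
    unfolding L_def[abs_def] by measurable
  have lim: "AE x in sphere_measure. (\<lambda>k. g k x) \<longlonglongrightarrow> L x"
    using conv by eventually_elim (simp add: L_def convergent_LIMSEQ_iff)
  have fatou: "(\<integral>\<^sup>+x. ennreal ((f n x - L x)\<^sup>2) \<partial>sphere_measure) \<le> ennreal (((1/2) ^ k)\<^sup>2)"
    if n: "n \<ge> N k" for n k
  proof -
    have "(\<integral>\<^sup>+x. ennreal ((f n x - L x)\<^sup>2) \<partial>sphere_measure)
        = (\<integral>\<^sup>+x. liminf (\<lambda>j. ennreal ((f n x - g j x)\<^sup>2)) \<partial>sphere_measure)"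
    proof (rule nn_integral_cong_AE, use lim in eventually_elim)
      case (elim x)
      then have "(\<lambda>j. ennreal ((f n x - g j x)\<^sup>2)) \<longlonglongrightarrow> ennreal ((f n x - L x)\<^sup>2)"
        by (intro tendsto_intros)
      then show ?case
        by (rule lim_imp_Liminf[OF trivial_limit_sequentially, symmetric])
    qed
    also have "\<dots> \<le> liminf (\<lambda>j. \<integral>\<^sup>+x. ennreal ((f n x - g j x)\<^sup>2) \<partial>sphere_measure)"
      by (rule nn_integral_liminf) measurable
    also have "\<dots> \<le> limsup (\<lambda>j. \<integral>\<^sup>+x. ennreal ((f n x - g j x)\<^sup>2) \<partial>sphere_measure)"
      by (rule Liminf_le_Limsup) simp
    also have "\<dots> \<le> ennreal (((1/2) ^ k)\<^sup>2)"
    proof (rule Limsup_bounded, rule eventually_sequentiallyI)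
      fix j assume j: "j \<ge> k"
      have "(\<integral>\<^sup>+x. ennreal ((f n x - g j x)\<^sup>2) \<partial>sphere_measure)
          = ennreal ((norm (X n - X (r j)))\<^sup>2)"
        using f by (simp add: g_def abs_sphere_L2_diff sq_integrable_diff flip: norm_abs_sphere_L2 f(2))
      also have "\<dots> \<le> ennreal (((1/2) ^ k)\<^sup>2)"
        by (intro ennreal_leI power_mono less_imp_le[OF N[OF n r[OF j]]] norm_ge_zero)
      finally show "(\<integral>\<^sup>+x. ennreal ((f n x - g j x)\<^sup>2) \<partial>sphere_measure) \<le> ennreal (((1/2) ^ k)\<^sup>2)" .
    qed
    finally show ?thesis .
  qed
  have fL: "sq_integrable (\<lambda>x. f n x - L x)" if "n \<ge> N k" for n k
    unfolding sq_integrable_def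
    using order_le_less_trans[OF fatou[OF that]]
    by (auto intro!: integrableI_bounded)
  have L: "sq_integrable L"
    using sq_integrable_diff[OF f(1)[of "N 0"] fL[of 0 "N 0"]] by simp
  have "X \<longlonglongrightarrow> abs_sphere_L2 L"
  proof (rule LIMSEQ_I)
    fix e :: real assume "0 < e"
    then obtain k where k: "(1/2) ^ k < e"
      using real_arch_pow_inv[of e "1/2"] by auto
    show "\<exists>no. \<forall>n\<ge>no. norm (X n - abs_sphere_L2 L) < e"
    proof (intro exI allI impI)
      fix n assume n: "n \<ge> N k"
      have "X n - abs_sphere_L2 L = abs_sphere_L2 (\<lambda>x. f n x - L x)"
        using L f by (metis abs_sphere_L2_diff)
      then have "ennreal ((norm (X n - abs_sphere_L2 L))\<^sup>2) \<le> ennreal (((1/2) ^ k)\<^sup>2)"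
        using fatou[OF n] fL[OF n] by (simp add: norm_abs_sphere_L2)
      then have "(norm (X n - abs_sphere_L2 L))\<^sup>2 \<le> ((1/2) ^ k)\<^sup>2"
        by (simp add: ennreal_le_iff)
      then have "norm (X n - abs_sphere_L2 L) \<le> (1/2) ^ k"
        by (rule power2_le_imp_le) simp
      with k show "norm (X n - abs_sphere_L2 L) < e" by simp
    qed
  qed
  then show "convergent X" by (auto simp: convergent_def)
qed

lemma subspace_closure:
  fixes S :: "'b::real_normed_vector set"
  assumes "subspace S"
  shows "subspace (closure S)"
  unfolding subspace_def
proof (intro conjI ballI allI)
  show "0 \<in> closure S"
    using subspace_0[OF assms] closure_subset by blast
  fix x y c assume "x \<in> closure S"
  then obtain a where a: "\<And>n. a n \<in> S" "a \<longlonglongrightarrow> x"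
    by (auto simp: closure_sequential)
  show "c *\<^sub>R x \<in> closure S"
    unfolding closure_sequential using a assms
    by (intro exI[of _ "\<lambda>n. c *\<^sub>R a n"]) (auto intro: subspace_scale tendsto_intros)
  assume "y \<in> closure S"
  then obtain b where b: "\<And>n. b n \<in> S" "b \<longlonglongrightarrow> y"
    by (auto simp: closure_sequential)
  show "x + y \<in> closure S"
    unfolding closure_sequential using a b assms
    by (intro exI[of _ "\<lambda>n. a n + b n"]) (auto intro: subspace_add tendsto_intros)
qed

lemma closure_span_countable:
  fixes K :: "'b::real_normed_vector set"
  assumes "countable K"
  obtains D where "countable D" "span K \<subseteq> closure D"
proof
  define comb where "comb xs = sum_list (map (\<lambda>(q, k). of_rat q *\<^sub>R k) xs)" for xs :: "(rat \<times> 'b) list"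
  define D where "D = comb ` lists (UNIV \<times> K)"
  show "countable D"
    unfolding D_def using assms by (intro countable_image countable_lists countable_SIGMA) auto
  show "span K \<subseteq> closure D"
  proof
    fix x assume "x \<in> span K"
    then show "x \<in> closure D"
    proof (induction rule: span_induct_alt)
      case base
      have "comb [] \<in> D" unfolding D_def by blast
      then show ?case using closure_subset[of D] by (auto simp: comb_def)
    next
      case (step c x y)
      show ?case
        unfolding closure_approachable
      proof (intro allI impI)
        fix e :: real assume e: "0 < e"
        from step(2) e obtain d where d: "d \<in> D" "dist d y < e / 2"
          unfolding closure_approachable by (metis half_gt_zero)
        then obtain xs where xs: "xs \<in> lists (UNIV \<times> K)" "d = comb xs"
          by (auto simp: D_def)
        define \<delta> where "\<delta> = e / (2 * (norm x + 1))"
        have "\<delta> > 0" using e by (auto simp: \<delta>_def add_nonneg_pos intro!: divide_pos_pos)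
        then obtain q where q: "c < of_rat q" "of_rat q < c + \<delta>"
          using of_rat_dense[of c "c + \<delta>"] by auto
        have "norm (of_rat q *\<^sub>R x - c *\<^sub>R x) = \<bar>of_rat q - c\<bar> * norm x"
          by (simp flip: scaleR_left_diff_distrib)
        also have "\<dots> \<le> \<delta> * (norm x + 1)"
          using q \<open>\<delta> > 0\<close> by (intro mult_mono) auto
        also have "\<dots> = e / 2"
          using norm_ge_zero[of x] by (simp add: \<delta>_def field_simps add_nonneg_eq_0_iff)
        finally have "norm (of_rat q *\<^sub>R x - c *\<^sub>R x) \<le> e / 2" .
        moreover have "norm ((of_rat q *\<^sub>R x + d) - (c *\<^sub>R x + y))
            \<le> norm (of_rat q *\<^sub>R x - c *\<^sub>R x) + norm (d - y)"
          by (rule norm_diff_triangle_ineq)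
        ultimately have "dist (of_rat q *\<^sub>R x + d) (c *\<^sub>R x + y) < e"
          using d(2) by (simp add: dist_norm)
        moreover have "of_rat q *\<^sub>R x + d = comb ((q, x) # xs)"
          by (simp add: comb_def xs)
        moreover have "comb ((q, x) # xs) \<in> D"
          unfolding D_def using xs step(1) by (intro imageI) auto
        ultimately show "\<exists>z\<in>D. dist z (c *\<^sub>R x + y) < e"
          by auto
      qed
    qed
  qed
qed

lemma sphere_L2_tendstoI:
  fixes f :: "nat \<Rightarrow> 'a::euclidean_space \<Rightarrow> real"
  assumes "\<And>n. sq_integrable (f n)" "sq_integrable g" "sq_integrable w"
    and "\<And>n x. x \<in> sphere 0 1 \<Longrightarrow> \<bar>f n x\<bar> \<le> w x"
    and "\<And>x. x \<in> sphere 0 1 \<Longrightarrow> (\<lambda>n. f n x) \<longlonglongrightarrow> g x"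
  shows "(\<lambda>n. abs_sphere_L2 (f n)) \<longlonglongrightarrow> abs_sphere_L2 g"
proof -
  have [measurable]: "f n \<in> borel_measurable sphere_measure" "g \<in> borel_measurable sphere_measure" for n
    using assms by (auto intro: sq_integrable_measurable)
  have gw: "\<bar>g x\<bar> \<le> w x" if "x \<in> sphere 0 1" for x
    using assms(4,5)[OF that] by (intro LIMSEQ_le_const2[OF tendsto_rabs]) auto
  have "(\<lambda>n. LINT x|sphere_measure. (f n x - g x)\<^sup>2) \<longlonglongrightarrow> (LINT x|(sphere_measure :: 'a measure). 0)"
  proof (rule integral_dominated_convergence[where w = "\<lambda>x. 4 * (w x)\<^sup>2"])
    show "integrable sphere_measure (\<lambda>x. 4 * (w x)\<^sup>2)"
      using assms(3) by (simp add: sq_integrable_sq)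
    show "AE x in sphere_measure. (\<lambda>n. (f n x - g x)\<^sup>2) \<longlonglongrightarrow> 0"
    proof (rule AE_I2)
      fix x :: 'a assume "x \<in> space sphere_measure"
      then have "(\<lambda>n. (f n x - g x)\<^sup>2) \<longlonglongrightarrow> (g x - g x)\<^sup>2"
        by (intro tendsto_intros assms(5)) simp
      then show "(\<lambda>n. (f n x - g x)\<^sup>2) \<longlonglongrightarrow> 0" by simp
    qed
    show "AE x in sphere_measure. norm ((f n x - g x)\<^sup>2) \<le> 4 * (w x)\<^sup>2" for n
    proof (rule AE_I2)
      fix x :: 'a assume "x \<in> space sphere_measure"
      then have "\<bar>f n x - g x\<bar> \<le> 2 * w x"
        using assms(4)[of x n] gw[of x] by simp
      then have "\<bar>f n x - g x\<bar>\<^sup>2 \<le> (2 * w x)\<^sup>2"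
        by (intro power_mono) auto
      then show "norm ((f n x - g x)\<^sup>2) \<le> 4 * (w x)\<^sup>2"
        by (simp add: power_mult_distrib)
    qed
  qed measurable
  moreover have "(LINT x|sphere_measure. (f n x - g x)\<^sup>2) = (norm (abs_sphere_L2 (f n) - abs_sphere_L2 g))\<^sup>2" for n
    unfolding power2_norm_eq_inner using assms(1,2)
    by (simp add: abs_sphere_L2_diff inner_abs_sphere_L2 sq_integrable_diff power2_eq_square)
  ultimately have "(\<lambda>n. sqrt ((norm (abs_sphere_L2 (f n) - abs_sphere_L2 g))\<^sup>2)) \<longlonglongrightarrow> sqrt 0"
    by (intro tendsto_real_sqrt) simp
  then show ?thesis
    by (subst tendsto_dist_iff) (simp add: dist_norm)
qed

lemma sphere_indicator_measurable:
  "B \<in> sets borel \<Longrightarrow> (indicator B :: 'a::euclidean_space \<Rightarrow> real) \<in> borel_measurable sphere_measure"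
  by (subst measurable_cong_sets[OF sets_sphere_measure refl])
     (intro measurable_restrict_space1 borel_measurable_indicator)

lemma sq_integrable_indicator:
  "B \<in> sets borel \<Longrightarrow> sq_integrable (indicator B :: 'a::euclidean_space \<Rightarrow> real)"
  by (rule sq_integrable_bounded[where c = 1]) (auto intro: sphere_indicator_measurable simp: indicator_def)

lemma sphere_L2_separable:
  obtains D :: "'a::euclidean_space sphere_L2 set" where "countable D" "closure D = UNIV"
proof -
  obtain B0 :: "'a set set" where B0: "countable B0" "topological_basis B0"
    using ex_countable_basis by blast
  define G where "G = Inter ` {b. finite b \<and> b \<subseteq> B0}"
  have "countable G"
    unfolding G_def by (intro countable_image countable_Collect_finite_subset B0)
  have G_Int: "Int_stable G"
    unfolding Int_stable_def G_def
  proof safe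
    fix b c assume "finite b" "b \<subseteq> B0" "finite c" "c \<subseteq> B0"
    then show "\<Inter>b \<inter> \<Inter>c \<in> Inter ` {b. finite b \<and> b \<subseteq> B0}"
      by (intro image_eqI[where x = "b \<union> c"]) auto
  qed
  have B0_open: "open b" if "b \<in> B0" for b
    using topological_basis_open[OF B0(2) that] .
  have G_open: "open A" if "A \<in> G" for A
    using that B0_open by (auto simp: G_def intro!: open_Inter)
  have "B0 \<subseteq> G"
    unfolding G_def by (auto intro!: image_eqI[where x = "{x}" for x])
  have borel: "sets borel = sigma_sets UNIV G"
  proof -
    have "sets borel = sigma_sets UNIV B0"
      by (subst borel_eq_countable_basis[OF B0]) simp
    also have "\<dots> = sigma_sets UNIV G"
    proof (rule antisym)
      show "sigma_sets UNIV B0 \<subseteq> sigma_sets UNIV G"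
        by (rule sigma_sets_mono') fact
      have "G \<subseteq> sets borel" using G_open by auto
      then show "sigma_sets UNIV G \<subseteq> sigma_sets UNIV B0"
        using \<open>sets borel = sigma_sets UNIV B0\<close>
        by (metis sets.sigma_sets_subset space_borel)
    qed
    finally show ?thesis .
  qed
  define ind where "ind A = abs_sphere_L2 (indicator A :: 'a \<Rightarrow> real)" for A
  define W where "W = closure (span (ind ` G))"
  have W: "subspace W" "closed W"
    unfolding W_def by (auto intro: subspace_closure)
  have base: "ind A \<in> W" if "A \<in> G" for A
    unfolding W_def using that by (intro subsetD[OF closure_subset] span_base imageI)
  have UNIV_G: "UNIV \<in> G"
    unfolding G_def by (intro image_eqI[where x = "{}"]) auto
  have ind_W: "ind A \<in> W" if "A \<in> sets borel" for A
    using G_Int Pow_UNIV[THEN equalityD2, THEN subset_trans[OF subset_UNIV]] that[unfolded borel]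
  proof (induction rule: sigma_sets_induct_disjoint)
    fix A assume "A \<in> G" then show "ind A \<in> W" by (rule base)
  next
    have "ind {} = 0"
      by (simp add: ind_def zero_sphere_L2_def indicator_def[abs_def])
    then show "ind {} \<in> W" using W by (simp add: subspace_0)
  next
    fix A assume A: "A \<in> sigma_sets UNIV G" "ind A \<in> W"
    have "ind (UNIV - A) = ind UNIV - ind A"
      using A borel unfolding ind_def
      by (subst abs_sphere_L2_diff)
         (auto intro!: sq_integrable_indicator sq_integrable_one arg_cong[where f = abs_sphere_L2]
           simp: fun_eq_iff split: split_indicator)
    then show "ind (UNIV - A) \<in> W"
      using W A base[OF UNIV_G] by (simp add: subspace_diff)
  next
    fix A :: "nat \<Rightarrow> 'a set"
    assume A: "disjoint_family A" "range A \<subseteq> sigma_sets UNIV G" "\<And>i. ind (A i) \<in> W"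
    have Am: "A i \<in> sets borel" for i using A borel by auto
    have fin: "ind (\<Union>i<n. A i) \<in> W" for n
    proof (induction n)
      case 0
      have "ind {} = 0"
        by (simp add: ind_def zero_sphere_L2_def indicator_def[abs_def])
      then show ?case using W by (simp add: subspace_0)
    next
      case (Suc n)
      have disj: "x \<notin> A n" if "x \<in> A i" "i < n" for x i
        using A(1) that unfolding disjoint_family_on_def by (metis IntI UNIV_I emptyE less_irrefl)
      have "ind (\<Union>i<Suc n. A i) = ind (\<Union>i<n. A i) + ind (A n)"
        unfolding ind_def
      proof (subst abs_sphere_L2_add)
        show "sq_integrable (indicator (\<Union>i<n. A i) :: 'a \<Rightarrow> real)"
          "sq_integrable (indicator (A n) :: 'a \<Rightarrow> real)"
          using Am by (auto intro!: sq_integrable_indicator)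
        show "abs_sphere_L2 (indicator (\<Union>i<Suc n. A i)) =
          abs_sphere_L2 (\<lambda>x. indicator (\<Union>i<n. A i) x + indicator (A n) x)"
          using disj by (intro arg_cong[where f = abs_sphere_L2]) (auto simp: indicator_def less_Suc_eq fun_eq_iff)
      qed
      then show ?case using W Suc A(3) by (simp add: subspace_add)
    qed
    have "(\<lambda>n. ind (\<Union>i<n. A i)) \<longlonglongrightarrow> ind (\<Union>i. A i)"
      unfolding ind_def
    proof (rule sphere_L2_tendstoI[where w = "\<lambda>_. 1"])
      show "sq_integrable (indicator (\<Union>i<n. A i) :: 'a \<Rightarrow> real)" for n
        using Am by (auto intro!: sq_integrable_indicator)
      show "sq_integrable (indicator (\<Union>i. A i) :: 'a \<Rightarrow> real)"
        using Am by (auto intro!: sq_integrable_indicator)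
      show "sq_integrable (\<lambda>_ :: 'a. 1 :: real)"
        by (rule sq_integrable_one)
      show "(\<lambda>n. indicator (\<Union>i<n. A i) x :: real) \<longlonglongrightarrow> indicator (\<Union>i. A i) x" for x
        by (rule LIMSEQ_indicator_UN)
    qed (auto simp: indicator_def)
    then show "ind (\<Union>i. A i) \<in> W"
      using W(2) fin by (auto elim!: closed_sequentially)
  qed
  have all: "u \<in> W" for u
  proof -
    define f where "f = rep_sphere_L2 u"
    have f: "sq_integrable f" "abs_sphere_L2 f = u"
      by (auto simp: f_def sq_integrable_rep abs_rep_sphere_L2)
    obtain s where *: "\<forall>i. simple_function sphere_measure (s i)"
      "\<forall>x\<in>space sphere_measure. (\<lambda>i. s i x) \<longlonglongrightarrow> f x"
      "\<forall>i. \<forall>x\<in>space sphere_measure. dist (s i x) 0 \<le> 2 * dist (f x) 0"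
      using borel_measurable_implies_sequence_metric[OF sq_integrable_measurable[OF f(1)], of 0]
      by blast
    have s: "simple_function sphere_measure (s i)" "x \<in> sphere 0 1 \<Longrightarrow> (\<lambda>i. s i x) \<longlonglongrightarrow> f x"
      "x \<in> sphere 0 1 \<Longrightarrow> \<bar>s i x\<bar> \<le> 2 * \<bar>f x\<bar>" for i x
      using * by auto
    have simple: "sq_integrable h \<and> abs_sphere_L2 h \<in> W"
      if "simple_function sphere_measure h" for h :: "'a \<Rightarrow> real"
    proof -
      let ?Y = "h ` sphere 0 1"
      have fin: "finite ?Y"
        using that by (simp add: simple_function_def)
      have "\<exists>B. B \<in> sets borel \<and> h -` {y} \<inter> sphere 0 1 = sphere 0 1 \<inter> B" if "y \<in> ?Y" for y
        using \<open>simple_function sphere_measure h\<close> that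
        by (auto simp: simple_function_def sets_sphere_measure sets_restrict_space)
      then obtain B where B: "\<And>y. y \<in> ?Y \<Longrightarrow> B y \<in> sets borel"
        "\<And>y. y \<in> ?Y \<Longrightarrow> h -` {y} \<inter> sphere 0 1 = sphere 0 1 \<inter> B y"
        by metis
      define h' where "h' Z x = (\<Sum>y\<in>Z. y * indicator (B y) x)" for Z x
      have h': "sq_integrable (h' Z) \<and> abs_sphere_L2 (h' Z) \<in> W" if "finite Z" "Z \<subseteq> ?Y" for Z
        using that
      proof (induction rule: finite_induct)
        case empty
        have "abs_sphere_L2 (h' {}) = 0"
          by (simp add: h'_def[abs_def] zero_sphere_L2_def)
        then show ?case
          using W by (simp add: subspace_0) (simp add: h'_def[abs_def] sq_integrable_zero)
      next
        case (insert y Z)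
        have eq: "h' (insert y Z) = (\<lambda>x. y * indicator (B y) x + h' Z x)"
          using insert(1,2) by (intro ext) (simp add: h'_def del: sum_mult_indicator)
        have b: "sq_integrable (indicator (B y) :: 'a \<Rightarrow> real)" "ind (B y) \<in> W"
          using B(1)[of y] insert(4) by (auto intro: sq_integrable_indicator ind_W)
        have hZ: "sq_integrable (h' Z)" "abs_sphere_L2 (h' Z) \<in> W"
          using insert by auto
        have "abs_sphere_L2 (h' (insert y Z)) = y *\<^sub>R ind (B y) + abs_sphere_L2 (h' Z)"
          using hZ(1) b(1) unfolding eq ind_def
          by (simp add: abs_sphere_L2_scale abs_sphere_L2_add sq_integrable_scale)
        moreover have "sq_integrable (h' (insert y Z))"
          unfolding eq by (intro sq_integrable_add sq_integrable_scale hZ b)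
        ultimately show ?case
          using subspace_add[OF W(1) subspace_scale[OF W(1) b(2)] hZ(2)] by simp
      qed
      have eq: "h' ?Y x = h x" if "x \<in> sphere 0 1" for x
      proof -
        have "y * indicator (B y) x = (if h x = y then y else 0)" if "y \<in> ?Y" for y
        proof -
          have "x \<in> B y \<longleftrightarrow> h x = y"
            using B(2)[OF that] \<open>x \<in> sphere 0 1\<close> by blast
          then show ?thesis by simp
        qed
        then have "h' ?Y x = (\<Sum>y\<in>?Y. if h x = y then y else 0)"
          unfolding h'_def by (intro sum.cong refl)
        also have "\<dots> = h x"
          using fin imageI[OF that, of h] by (simp only: sum.delta'[of ?Y "h x" "\<lambda>y. y"] if_True)
        finally show ?thesis .
      qed
      have hY: "sq_integrable (h' ?Y)" "abs_sphere_L2 (h' ?Y) \<in> W"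
        using h'[OF fin] by auto
      have "sq_integrable h"
      proof -
        have "h \<in> borel_measurable sphere_measure"
          using that by (rule borel_measurable_simple_function)
        moreover have "integrable sphere_measure (\<lambda>x. (h x)\<^sup>2)"
          using sq_integrable_sq[OF hY(1)]
          by (rule Bochner_Integration.integrable_cong[THEN iffD1, OF refl, rotated]) (simp add: eq)
        ultimately show ?thesis by (simp add: sq_integrable_def)
      qed
      moreover have "abs_sphere_L2 h = abs_sphere_L2 (h' ?Y)"
        using \<open>sq_integrable h\<close> hY(1)
        by (intro Quotient3_rel_abs[OF Quotient3_sphere_L2])
           (auto simp: l2_rel_def eq intro!: AE_I2)
      ultimately show ?thesis using hY by simp
    qed
    have "(\<lambda>i. abs_sphere_L2 (s i)) \<longlonglongrightarrow> abs_sphere_L2 f"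
    proof (rule sphere_L2_tendstoI[where w = "\<lambda>x. 2 * \<bar>f x\<bar>"])
      show "sq_integrable (\<lambda>x. 2 * \<bar>f x\<bar>)"
        using f(1) by (intro sq_integrable_scale) (auto simp: sq_integrable_def)
    qed (use s f simple in auto)
    then show ?thesis
      using W(2) simple[OF s(1)] f(2) by (auto elim!: closed_sequentially)
  qed
  have "countable (ind ` G)"
    using \<open>countable G\<close> by (rule countable_image)
  then obtain D where D: "countable D" "span (ind ` G) \<subseteq> closure D"
    by (rule closure_span_countable)
  then have "W \<subseteq> closure D"
    unfolding W_def by (intro closure_minimal) auto
  with all have "closure D = UNIV" by auto
  with D(1) show ?thesis by (rule that)
qed

instance sphere_L2 :: (euclidean_space) second_countable_topology
proof
  obtain D :: "'a sphere_L2 set" where D: "countable D" "closure D = UNIV"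
    by (rule sphere_L2_separable)
  define B where "B = (\<lambda>(d, n). ball d (inverse (real (Suc n)))) ` (D \<times> UNIV)"
  have "topological_basis B"
  proof (rule topological_basisI)
    show "open b" if "b \<in> B" for b
      using that by (auto simp: B_def)
    fix U and x :: "'a sphere_L2" assume "open U" "x \<in> U"
    then obtain e where e: "e > 0" "ball x e \<subseteq> U"
      by (auto elim: openE)
    obtain n where n: "inverse (real (Suc n)) < e / 2"
      using reals_Archimedean[of "e / 2"] e by auto
    have "x \<in> closure D" using D by simp
    then obtain d where d: "d \<in> D" "dist d x < inverse (real (Suc n))"
      unfolding closure_approachable by (metis inverse_positive_iff_positive of_nat_0_less_iff zero_less_Suc)
    show "\<exists>b\<in>B. x \<in> b \<and> b \<subseteq> U"
    proof (intro bexI conjI)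
      show "ball d (inverse (real (Suc n))) \<in> B"
        using d by (auto simp: B_def)
      show "x \<in> ball d (inverse (real (Suc n)))"
        using d by simp
      have "dist x z < e" if "dist d z < inverse (real (Suc n))" for z
        using dist_triangle[of x z d] d(2) that n by (simp add: dist_commute)
      then show "ball d (inverse (real (Suc n))) \<subseteq> U"
        using e(2) by (auto simp: subset_iff)
    qed
  qed
  moreover have "countable B"
    unfolding B_def using D(1) by (intro countable_image countable_SIGMA) auto
  ultimately show "\<exists>B::'a sphere_L2 set set. countable B \<and> open = generate_topology B"
    by (blast dest: topological_basis_imp_subbasis)
qed

instance sphere_L2 :: (euclidean_space) banach ..

section \<open>The Laplace--Beltrami operator\<close>

primrec ck_on :: "nat \<Rightarrow> 'a::real_normed_vector set \<Rightarrow> ('a \<Rightarrow> 'b::real_normed_vector) \<Rightarrow> bool" where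
  "ck_on 0 W f \<longleftrightarrow> continuous_on W f"
| "ck_on (Suc k) W f \<longleftrightarrow>
     (\<exists>f'. (\<forall>x\<in>W. (f has_derivative f' x) (at x)) \<and> (\<forall>v. ck_on k W (\<lambda>x. f' x v)))"

definition smooth_on_sphere :: "('a::euclidean_space \<Rightarrow> 'b::real_normed_vector) \<Rightarrow> bool" where
  "smooth_on_sphere f \<longleftrightarrow>
     (\<exists>W g. open W \<and> sphere 0 1 \<subseteq> W \<and> (\<forall>k. ck_on k W g) \<and> (\<forall>x\<in>sphere 0 1. g x = f x))"

definition tangent_field :: "('a::euclidean_space \<Rightarrow> 'a) \<Rightarrow> bool" where
  "tangent_field X \<longleftrightarrow> (\<forall>x\<in>sphere 0 1. X x \<bullet> x = 0)"

text \<open>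
  A derivative within the sphere is determined only on the tangent space \<open>x\<^sup>\<bottom>\<close>. The gradient is the
  tangent vector representing it. The Levi-Civita derivative of a tangent field is the tangential
  part of its derivative, and the divergence is its trace over the tangent space; this equals the
  full trace of the derivative that is extended by \<open>0\<close> to the normal direction.
\<close>

definition sphere_grad :: "('a::euclidean_space \<Rightarrow> real) \<Rightarrow> 'a \<Rightarrow> 'a" where
  "sphere_grad \<phi> x =
     (THE v. v \<bullet> x = 0 \<and> (\<phi> has_derivative (\<lambda>h. v \<bullet> h)) (at x within sphere 0 1))"

definition sphere_div :: "('a::euclidean_space \<Rightarrow> 'a) \<Rightarrow> 'a \<Rightarrow> real" where
  "sphere_div X x =
     (let D = (THE D. (X has_derivative D) (at x within sphere 0 1) \<and> D x = 0)
      in \<Sum>b\<in>Basis. D b \<bullet> b)"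

lemma has_derivative_within_sphere_unique:
  fixes f :: "'a::euclidean_space \<Rightarrow> 'b::real_normed_vector"
  assumes D: "(f has_derivative D) (at x within sphere 0 1)"
    and D': "(f has_derivative D') (at x within sphere 0 1)"
    and x: "x \<in> sphere 0 1" and v: "v \<bullet> x = 0"
  shows "D v = D' v"
proof (cases "v = 0")
  case True
  with D D' show ?thesis
    by (simp add: linear_0[OF has_derivative_linear])
next
  case False
  define w where "w = v /\<^sub>R norm v"
  have w: "w \<bullet> w = 1" "w \<bullet> x = 0" "x \<bullet> w = 0" "x \<bullet> x = 1" "v = norm v *\<^sub>R w"
    using False v x by (auto simp: w_def inner_commute[of x] dot_square_norm power2_eq_square)
  define c where "c t = cos t *\<^sub>R x + sin t *\<^sub>R w" for t
  have c: "c t \<in> sphere 0 1" for t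
  proof -
    have "c t \<bullet> c t = (cos t)\<^sup>2 + (sin t)\<^sup>2"
      by (simp add: c_def inner_add_left inner_add_right w power2_eq_square)
    then show ?thesis by (simp add: norm_eq_1)
  qed
  have c': "(c has_derivative (\<lambda>h. h *\<^sub>R w)) (at 0)"
    unfolding c_def by (auto intro!: derivative_eq_intros)
  have c0: "c 0 = x" by (simp add: c_def)
  have "((\<lambda>t. f (c t)) has_derivative (\<lambda>h. E (h *\<^sub>R w))) (at 0)"
    if "(f has_derivative E) (at x within sphere 0 1)" for E
  proof -
    have "(f has_derivative E) (at (c 0) within c ` UNIV)"
      using that c unfolding c0 by (auto intro: has_derivative_subset)
    from has_derivative_in_compose[OF c' this] show ?thesis .
  qed
  from has_derivative_unique[OF this[OF D] this[OF D']]
  have "D (1 *\<^sub>R w) = D' (1 *\<^sub>R w)" by metis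
  then have "norm v *\<^sub>R D w = norm v *\<^sub>R D' w" by simp
  then show ?thesis
    using w(5) D D' by (metis has_derivative_linear linear_scale)
qed

lemma has_derivative_within_sphere_tangential:
  fixes f :: "'a::euclidean_space \<Rightarrow> 'b::real_normed_vector"
  assumes D: "(f has_derivative D) (at x within sphere 0 1)" and x: "x \<in> sphere 0 1"
  shows "(f has_derivative (\<lambda>h. D h - (h \<bullet> x) *\<^sub>R D x)) (at x within sphere 0 1)"
proof -
  let ?Z = "\<lambda>y. (y \<bullet> x - 1 + ((y - x) \<bullet> (y - x)) / 2) *\<^sub>R D x"
  have "(?Z has_derivative (\<lambda>h. (h \<bullet> x) *\<^sub>R D x)) (at x within sphere 0 1)"
    by (auto intro!: derivative_eq_intros)
  from has_derivative_diff[OF D this]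
  have *: "((\<lambda>y. f y - ?Z y) has_derivative (\<lambda>h. D h - (h \<bullet> x) *\<^sub>R D x)) (at x within sphere 0 1)" .
  have "?Z y = 0" if "y \<in> sphere 0 1" for y
  proof -
    have "(y - x) \<bullet> (y - x) = y \<bullet> y - 2 * (y \<bullet> x) + x \<bullet> x"
      by (simp add: inner_diff_left inner_diff_right inner_commute[of x y])
    also have "\<dots> = 2 - 2 * (y \<bullet> x)"
      using that x by (simp add: norm_eq_1)
    finally show ?thesis by (simp add: field_simps)
  qed
  then show ?thesis
    using x by (intro has_derivative_transform[OF _ _ *]) auto
qed

lemma sphere_grad_eq:
  assumes D: "(\<phi> has_derivative (\<lambda>h. G \<bullet> h)) (at x within sphere 0 1)" and x: "x \<in> sphere 0 1"
  shows "sphere_grad \<phi> x = G - (G \<bullet> x) *\<^sub>R x"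
  unfolding sphere_grad_def
proof (rule the_equality, intro conjI)
  have xx: "x \<bullet> x = 1" using x by (simp add: dot_square_norm)
  show "(G - (G \<bullet> x) *\<^sub>R x) \<bullet> x = 0"
    by (simp add: inner_diff_left xx)
  show D': "(\<phi> has_derivative (\<lambda>h. (G - (G \<bullet> x) *\<^sub>R x) \<bullet> h)) (at x within sphere 0 1)"
  proof -
    have "(\<lambda>h. (G - (G \<bullet> x) *\<^sub>R x) \<bullet> h) = (\<lambda>h. G \<bullet> h - (h \<bullet> x) *\<^sub>R (G \<bullet> x))"
      by (intro ext) (simp add: inner_diff_left inner_commute[of x])
    then show ?thesis
      using has_derivative_within_sphere_tangential[OF D x] by metis
  qed
  fix v assume v: "v \<bullet> x = 0 \<and> (\<phi> has_derivative (\<lambda>h. v \<bullet> h)) (at x within sphere 0 1)"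
  define u where "u = v - (G - (G \<bullet> x) *\<^sub>R x)"
  have "u \<bullet> x = 0"
    using v by (simp add: u_def inner_diff_left xx)
  from has_derivative_within_sphere_unique[OF conjunct2[OF v] D' x this]
  have "u \<bullet> u = 0" by (simp add: u_def inner_diff_left)
  then show "v = G - (G \<bullet> x) *\<^sub>R x" by (simp add: u_def)
qed

lemma sphere_div_eq:
  assumes D: "(X has_derivative D) (at x within sphere 0 1)" and x: "x \<in> sphere 0 1"
  shows "sphere_div X x = (\<Sum>b\<in>Basis. D b \<bullet> b) - D x \<bullet> x"
proof -
  let ?D = "\<lambda>h. D h - (h \<bullet> x) *\<^sub>R D x"
  have xx: "x \<bullet> x = 1" using x by (simp add: dot_square_norm)
  have D': "(X has_derivative ?D) (at x within sphere 0 1)"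
    by (rule has_derivative_within_sphere_tangential[OF D x])
  have "(THE D. (X has_derivative D) (at x within sphere 0 1) \<and> D x = 0) = ?D"
  proof (rule the_equality)
    show "(X has_derivative ?D) (at x within sphere 0 1) \<and> ?D x = 0"
      using D' by (simp add: xx)
    fix E assume E: "(X has_derivative E) (at x within sphere 0 1) \<and> E x = 0"
    then have lin: "linear E" "linear D"
      using D by (auto intro: has_derivative_linear)
    show "E = ?D"
    proof
      fix h
      have "(h - (h \<bullet> x) *\<^sub>R x) \<bullet> x = 0" by (simp add: inner_diff_left xx)
      from has_derivative_within_sphere_unique[OF conjunct1[OF E] D x this]
      have "E (h - (h \<bullet> x) *\<^sub>R x) = D (h - (h \<bullet> x) *\<^sub>R x)" .
      then show "E h = ?D h"
        using E linear_diff[OF lin(1)] linear_diff[OF lin(2)] linear_scale[OF lin(1)]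
          linear_scale[OF lin(2)] by simp
    qed
  qed
  then have "sphere_div X x = (\<Sum>b\<in>Basis. (D b - (b \<bullet> x) *\<^sub>R D x) \<bullet> b)"
    by (simp add: sphere_div_def Let_def)
  also have "\<dots> = (\<Sum>b\<in>Basis. D b \<bullet> b) - (\<Sum>b\<in>Basis. (D x \<bullet> b) * (x \<bullet> b))"
  proof -
    have "(D b - (b \<bullet> x) *\<^sub>R D x) \<bullet> b = D b \<bullet> b - (D x \<bullet> b) * (x \<bullet> b)" for b
      by (simp add: inner_diff_left inner_commute[of b x])
    then show ?thesis by (simp add: sum_subtractf)
  qed
  also have "(\<Sum>b\<in>Basis. (D x \<bullet> b) * (x \<bullet> b)) = D x \<bullet> x"
    by (rule euclidean_inner[symmetric])
  finally show ?thesis .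
qed

text \<open>
  \<open>\<nabla>\<close> and \<open>div\<close> of square-integrable objects are taken in the sense of distributions, i.e. by
  duality with smooth tangent fields and smooth functions.
\<close>

definition has_weak_gradient :: "('a::euclidean_space \<Rightarrow> real) \<Rightarrow> ('a \<Rightarrow> 'a) \<Rightarrow> bool" where
  "has_weak_gradient u G \<longleftrightarrow>
     sq_integrable u \<and> sq_integrable G \<and> (AE x in sphere_measure. G x \<bullet> x = 0) \<and>
     (\<forall>X. smooth_on_sphere X \<and> tangent_field X \<longrightarrow>
        (LINT x|sphere_measure. G x \<bullet> X x) = - (LINT x|sphere_measure. u x * sphere_div X x))"

definition has_weak_divergence :: "('a::euclidean_space \<Rightarrow> 'a) \<Rightarrow> ('a \<Rightarrow> real) \<Rightarrow> bool" where
  "has_weak_divergence G w \<longleftrightarrow>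
     sq_integrable G \<and> (AE x in sphere_measure. G x \<bullet> x = 0) \<and> sq_integrable w \<and>
     (\<forall>\<phi>. smooth_on_sphere \<phi> \<longrightarrow>
        (LINT x|sphere_measure. w x * \<phi> x) = - (LINT x|sphere_measure. G x \<bullet> sphere_grad \<phi> x))"

text \<open>
  \<open>\<Delta> = div \<circ> \<nabla>\<close> with domain \<open>{u. \<nabla>u \<in> L\<^sup>2, \<Delta>u \<in> L\<^sup>2}\<close>. The \<open>THE\<close> in \<open>laplace_beltrami\<close> is
  well-defined on the domain because smooth functions and smooth tangent fields are dense in the
  respective \<open>L\<^sup>2\<close> spaces; outside the domain its value is irrelevant.
\<close>

definition has_laplacian :: "'a::euclidean_space sphere_L2 \<Rightarrow> 'a sphere_L2 \<Rightarrow> bool" where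
  "has_laplacian u w \<longleftrightarrow>
     (\<exists>G. has_weak_gradient (rep_sphere_L2 u) G \<and> has_weak_divergence G (rep_sphere_L2 w))"

definition laplace_domain :: "'a::euclidean_space sphere_L2 set" where
  "laplace_domain = {u. \<exists>w. has_laplacian u w}"

definition laplace_beltrami :: "'a::euclidean_space sphere_L2 \<Rightarrow> 'a sphere_L2" where
  "laplace_beltrami u = (THE w. has_laplacian u w)"

text \<open>
  Eigenvalues are repeated according to multiplicity, since \<open>e\<close> is a basis; indexing starts at \<open>1\<close>
  and \<open>lam 0\<close>, \<open>e 0\<close> play no role.
\<close>

definition laplace_eigenbasis :: "(nat \<Rightarrow> real) \<Rightarrow> (nat \<Rightarrow> 'a::euclidean_space sphere_L2) \<Rightarrow> bool" where
  "laplace_eigenbasis lam e \<longleftrightarrow>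
     (\<forall>k\<ge>1. e k \<in> laplace_domain \<and> - laplace_beltrami (e k) = lam k *\<^sub>R e k) \<and>
     (\<forall>j\<ge>1. \<forall>k\<ge>1. e j \<bullet> e k = (if j = k then 1 else 0)) \<and>
     closure (span (e ` {1..})) = UNIV \<and>
     (\<forall>k\<ge>1. 0 \<le> lam k) \<and> mono_on {1..} lam \<and> filterlim lam at_top sequentially"

section \<open>Semigroups, controls, mild solutions and Galerkin approximations\<close>

definition contraction_semigroup :: "(real \<Rightarrow> 'h \<Rightarrow> 'h::real_normed_vector) \<Rightarrow> bool" where
  "contraction_semigroup P \<longleftrightarrow>
     (\<forall>t\<ge>0. bounded_linear (P t) \<and> (\<forall>x. norm (P t x) \<le> norm x)) \<and>
     (\<forall>x. P 0 x = x) \<and>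
     (\<forall>s\<ge>0. \<forall>t\<ge>0. \<forall>x. P (s + t) x = P s (P t x)) \<and>
     (\<forall>x. ((\<lambda>t. P t x) \<longlongrightarrow> x) (at_right 0))"

definition generates :: "'h::real_normed_vector set \<Rightarrow> ('h \<Rightarrow> 'h) \<Rightarrow> (real \<Rightarrow> 'h \<Rightarrow> 'h) \<Rightarrow> bool" where
  "generates D A P \<longleftrightarrow>
     (\<forall>x y. ((\<lambda>h. (P h x - x) /\<^sub>R h) \<longlongrightarrow> y) (at_right 0) \<longleftrightarrow> x \<in> D \<and> y = A x)"

definition strongly_measurable :: "'s measure \<Rightarrow> ('s \<Rightarrow> 'v::real_normed_vector) \<Rightarrow> bool" where
  "strongly_measurable M f \<longleftrightarrow>
     (\<exists>s. (\<forall>i::nat. simple_function M (s i)) \<and> (AE x in M. (\<lambda>i. s i x) \<longlonglongrightarrow> f x))"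

text \<open>
  \<open>L\<^sup>q(0,T;V)\<close> for Bochner-measurable functions; its elements are kept as functions rather than
  classes, and only their values on \<open>[0,T]\<close> matter. \<open>V\<close> need not be separable, so Borel measurability
  would not be the right notion.
\<close>

definition Lq_fun :: "real \<Rightarrow> real \<Rightarrow> (real \<Rightarrow> 'v::real_normed_vector) set" where
  "Lq_fun q T = {f. strongly_measurable (lebesgue_on {0..T}) f \<and>
                    integrable (lebesgue_on {0..T}) (\<lambda>s. norm (f s) powr q)}"

definition admissible_controls ::
    "'v::real_normed_vector set \<Rightarrow> real \<Rightarrow> real \<Rightarrow> (real \<Rightarrow> 'v) set" where
  "admissible_controls U q T = {f \<in> Lq_fun q T. AE s in lebesgue_on {0..T}. f s \<in> U}"

text \<open>
  \<open>C([0,T],Y)\<close>; the functions are fixed to be \<^term>\<open>undefined\<close> outside \<open>[0,T]\<close>, so that unique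
  existence can be stated with \<open>\<exists>!\<close>.
\<close>

definition C_paths :: "real \<Rightarrow> 'h::topological_space set \<Rightarrow> (real \<Rightarrow> 'h) set" where
  "C_paths T Y = {y. y \<in> extensional {0..T} \<and> continuous_on {0..T} y \<and> y ` {0..T} \<subseteq> Y}"

text \<open>
  The variation-of-constants formula
  \<open>y(t) = S(t) x + \<integral>\<^sub>0\<^sup>t S(t-s) F(y(s)) ds + \<integral>\<^sub>0\<^sup>t S(t-s) C(u(s)) ds\<close> with Bochner integrals. Integrability
  is demanded because the integral of a non-integrable function is \<open>0\<close> by convention.
\<close>

definition voc_solution ::
    "(real \<Rightarrow> 'h \<Rightarrow> 'h::{banach, second_countable_topology}) \<Rightarrow> ('h \<Rightarrow> 'h) \<Rightarrow> ('v \<Rightarrow> 'h) \<Rightarrow>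
     real \<Rightarrow> 'h set \<Rightarrow> 'h \<Rightarrow> (real \<Rightarrow> 'v) \<Rightarrow> (real \<Rightarrow> 'h) \<Rightarrow> bool" where
  "voc_solution S F C T Y x u y \<longleftrightarrow>
     y \<in> C_paths T Y \<and>
     (\<forall>t\<in>{0..T}.
        integrable (lebesgue_on {0..t}) (\<lambda>s. S (t - s) (F (y s))) \<and>
        integrable (lebesgue_on {0..t}) (\<lambda>s. S (t - s) (C (u s))) \<and>
        y t = S t x + (LINT s|lebesgue_on {0..t}. S (t - s) (F (y s)))
                    + (LINT s|lebesgue_on {0..t}. S (t - s) (C (u s))))"

abbreviation is_mild_solution ::
    "(real \<Rightarrow> 'h \<Rightarrow> 'h::{banach, second_countable_topology}) \<Rightarrow> ('h \<Rightarrow> 'h) \<Rightarrow> ('v \<Rightarrow> 'h) \<Rightarrow>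
     real \<Rightarrow> 'h \<Rightarrow> (real \<Rightarrow> 'v) \<Rightarrow> (real \<Rightarrow> 'h) \<Rightarrow> bool" where
  "is_mild_solution P F C T x u y \<equiv> voc_solution P F C T UNIV x u y"

definition mild_solution ::
    "(real \<Rightarrow> 'h \<Rightarrow> 'h::{banach, second_countable_topology}) \<Rightarrow> ('h \<Rightarrow> 'h) \<Rightarrow> ('v \<Rightarrow> 'h) \<Rightarrow>
     real \<Rightarrow> 'h \<Rightarrow> (real \<Rightarrow> 'v) \<Rightarrow> real \<Rightarrow> 'h" where
  "mild_solution P F C T x u = (THE y. is_mild_solution P F C T x u y)"

definition orth_proj :: "'h::real_inner set \<Rightarrow> 'h \<Rightarrow> 'h" where
  "orth_proj Y x = (THE p. p \<in> Y \<and> (\<forall>z\<in>Y. (x - p) \<bullet> z = 0))"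

definition exp_op :: "('h \<Rightarrow> 'h::real_normed_vector) \<Rightarrow> real \<Rightarrow> 'h \<Rightarrow> 'h" where
  "exp_op A t x = (\<Sum>k. (t ^ k / fact k) *\<^sub>R (A ^^ k) x)"

definition galerkin_space :: "(nat \<Rightarrow> 'h::real_vector) \<Rightarrow> nat \<Rightarrow> 'h set" where
  "galerkin_space e N = span (e ` {1..N})"

definition galerkin_proj :: "(nat \<Rightarrow> 'h::real_inner) \<Rightarrow> nat \<Rightarrow> 'h \<Rightarrow> 'h" where
  "galerkin_proj e N = orth_proj (galerkin_space e N)"

definition galerkin_laplacian ::
    "(nat \<Rightarrow> 'a::euclidean_space sphere_L2) \<Rightarrow> nat \<Rightarrow> 'a sphere_L2 \<Rightarrow> 'a sphere_L2" where
  "galerkin_laplacian e N = galerkin_proj e N \<circ> laplace_beltrami \<circ> galerkin_proj e N"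

definition is_galerkin_solution ::
    "(nat \<Rightarrow> 'a::euclidean_space sphere_L2) \<Rightarrow> nat \<Rightarrow> ('a sphere_L2 \<Rightarrow> 'a sphere_L2) \<Rightarrow>
     ('v \<Rightarrow> 'a sphere_L2) \<Rightarrow> real \<Rightarrow> 'a sphere_L2 \<Rightarrow> (real \<Rightarrow> 'v) \<Rightarrow> (real \<Rightarrow> 'a sphere_L2) \<Rightarrow> bool" where
  "is_galerkin_solution e N F C T x u y \<longleftrightarrow>
     voc_solution (exp_op (galerkin_laplacian e N)) (galerkin_proj e N \<circ> F) (galerkin_proj e N \<circ> C)
       T (galerkin_space e N) (galerkin_proj e N x) u y"

definition galerkin_solution ::
    "(nat \<Rightarrow> 'a::euclidean_space sphere_L2) \<Rightarrow> nat \<Rightarrow> ('a sphere_L2 \<Rightarrow> 'a sphere_L2) \<Rightarrow>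
     ('v \<Rightarrow> 'a sphere_L2) \<Rightarrow> real \<Rightarrow> 'a sphere_L2 \<Rightarrow> (real \<Rightarrow> 'v) \<Rightarrow> real \<Rightarrow> 'a sphere_L2" where
  "galerkin_solution e N F C T x u = (THE y. is_galerkin_solution e N F C T x u y)"

end

theory Submission
  imports Defs
begin

text \<open>
  The semigroup acts on the eigenbasis by \<open>P(t) e\<^sub>k = exp (- \<lambda>\<^sub>k t) e\<^sub>k\<close>, so \<open>exp (t L\<^sub>N)\<close> and \<open>P(t)\<close> agree on the
  range of \<open>\<Pi>\<^sub>N\<close>: the Galerkin approximation solves the same mild problem with \<open>\<Pi>\<^sub>N F\<close>, \<open>\<Pi>\<^sub>N C\<close>,
  \<open>\<Pi>\<^sub>N x\<close> as data, and both problems are solved by Banach's fixed point theorem. On the tail,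
  \<open>\<parallel>P(t) (1 - \<Pi>\<^sub>N)\<parallel> \<le> exp (- \<lambda>\<^bsub>N+1\<^esub> t)\<close>, hence convolving \<open>P\<close> with \<open>(1 - \<Pi>\<^sub>N) h\<close> for \<open>h\<close> bounded by \<open>M\<close>
  gives at most \<open>M / \<lambda>\<^bsub>N+1\<^esub>\<close>. Since \<open>F(y(s))\<close> and \<open>C(u(s))\<close> are bounded uniformly in \<open>u\<close>, Gronwall's
  inequality bounds the error by a multiple of \<open>\<parallel>x - \<Pi>\<^sub>N x\<parallel> + M / \<lambda>\<^bsub>N+1\<^esub>\<close>, which tends to \<open>0\<close>.
\<close>

section \<open>Measurability and integration on intervals\<close>

text \<open>Completeness of Lebesgue measure: off a null set \<open>N\<close> the preimages under
  \<open>f\<close> and \<open>g\<close> agree, and the part of the preimage of \<open>g\<close>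
  inside \<open>N\<close> is measurable as a subset of a null set.\<close>

lemma borel_measurable_AE_lebesgue_on:
  fixes f g :: "'a::euclidean_space \<Rightarrow> 'b::topological_space"
  assumes S: "S \<in> sets lebesgue" and f: "f \<in> borel_measurable (lebesgue_on S)"
    and eq: "AE x in lebesgue_on S. f x = g x"
  shows "g \<in> borel_measurable (lebesgue_on S)"
proof (rule measurableI)
  fix A :: "'b set" assume A: "A \<in> sets borel"
  obtain N where N: "{x \<in> space (lebesgue_on S). \<not> f x = g x} \<subseteq> N" "N \<in> null_sets (lebesgue_on S)"
    using eq unfolding eventually_ae_filter by blast
  then have N': "N \<subseteq> S" "N \<in> null_sets lebesgue"
    using null_sets_restrict_space[OF S] by blast+
  have "g -` A \<inter> N \<in> null_sets (lebesgue_on S)"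
    using null_sets_completion_subset[OF _ N'(2), of "g -` A \<inter> N"] N'(1)
    by (auto simp: null_sets_restrict_space[OF S])
  moreover have "f -` A \<inter> space (lebesgue_on S) \<in> sets (lebesgue_on S)"
    using f A by (rule measurable_sets)
  ultimately have "(f -` A \<inter> space (lebesgue_on S) - N) \<union> (g -` A \<inter> N) \<in> sets (lebesgue_on S)"
    using N(2) by blast
  also have "(f -` A \<inter> space (lebesgue_on S) - N) \<union> (g -` A \<inter> N) = g -` A \<inter> space (lebesgue_on S)"
    using N(1) N'(1) by auto
  finally show "g -` A \<inter> space (lebesgue_on S) \<in> sets (lebesgue_on S)" .
qed simp

text \<open>Makes the forcing \<open>C (u s)\<close> Borel measurable for a Bochner-measurable
  control. \<open>C\<close> maps simple functions to simple functions whether or not the control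
  space is separable, and the limit is then taken in the codomain of \<open>C\<close>.\<close>

lemma borel_measurable_strongly_measurable_comp:
  fixes f :: "'a::euclidean_space \<Rightarrow> 'v::real_normed_vector" and C :: "'v \<Rightarrow> 'b::metric_space"
  assumes S: "S \<in> sets lebesgue" and f: "strongly_measurable (lebesgue_on S) f"
    and C: "continuous_on UNIV C"
  shows "(\<lambda>x. C (f x)) \<in> borel_measurable (lebesgue_on S)"
proof -
  obtain s where s: "\<And>i::nat. simple_function (lebesgue_on S) (s i)"
    "AE x in lebesgue_on S. (\<lambda>i. s i x) \<longlonglongrightarrow> f x"
    using f unfolding strongly_measurable_def by blast
  obtain N where N: "{x \<in> space (lebesgue_on S). \<not> (\<lambda>i. s i x) \<longlonglongrightarrow> f x} \<subseteq> N" "N \<in> null_sets (lebesgue_on S)"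
    using s(2) unfolding eventually_ae_filter by blast
  \<comment> \<open>Freezing all functions at the value \<open>C 0\<close> on the exceptional set
    turns almost-everywhere convergence into convergence at every point.\<close>
  have "(\<lambda>x. if x \<in> N then C 0 else C (f x)) \<in> borel_measurable (lebesgue_on S)"
  proof (rule borel_measurable_LIMSEQ_metric)
    show "(\<lambda>x. if x \<in> N then C 0 else C (s i x)) \<in> borel_measurable (lebesgue_on S)" for i
    proof (rule measurable_If_set)
      show "(\<lambda>x. C (s i x)) \<in> borel_measurable (lebesgue_on S)"
        using simple_function_compose[OF s(1)[of i], of C]
        by (intro borel_measurable_simple_function) (simp add: comp_def)
      show "N \<inter> space (lebesgue_on S) \<in> sets (lebesgue_on S)"
        using N(2) by (intro sets.Int sets.top) blast
    qed simp
    fix x assume x: "x \<in> space (lebesgue_on S)"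
    have "(\<lambda>i. C (s i x)) \<longlonglongrightarrow> C (f x)" if "x \<notin> N"
      using N(1) x that C by (intro continuous_on_tendsto_compose[OF C]) auto
    then show "(\<lambda>i. if x \<in> N then C 0 else C (s i x)) \<longlonglongrightarrow> (if x \<in> N then C 0 else C (f x))"
      by simp
  qed
  moreover have "AE x in lebesgue_on S. (if x \<in> N then C 0 else C (f x)) = C (f x)"
    using AE_not_in[OF N(2)] by eventually_elim simp
  ultimately show ?thesis
    by (rule borel_measurable_AE_lebesgue_on[OF S])
qed

lemma borel_measurable_continuous_on_Icc:
  fixes f :: "real \<Rightarrow> 'b::topological_space"
  assumes "continuous_on {0..T} f"
  shows "f \<in> borel_measurable (lebesgue_on {0..T})"
proof -
  have "f \<in> borel_measurable (restrict_space borel {0..T})"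
    using assms by (rule borel_measurable_continuous_on_restrict)
  then have "f \<in> borel_measurable (restrict_space lborel {0..T})"
    by (simp cong: measurable_cong_sets add: measurable_cong_sets[OF sets_restrict_space_cong[OF sets_lborel]])
  then show ?thesis
    by (simp add: measurable_def space_restrict_space sets_restrict_space) 
       (fastforce dest: sets_completionI_sets)
qed

lemma finite_measure_lebesgue_on_Icc: "finite_measure (lebesgue_on {0..T::real})"
  by (intro finite_measure_lebesgue_on) auto

lemma integrable_AE_bounded_Icc:
  fixes f :: "real \<Rightarrow> 'b::{banach, second_countable_topology}"
  assumes "f \<in> borel_measurable (lebesgue_on {0..T})" "AE s in lebesgue_on {0..T}. norm (f s) \<le> B"
  shows "integrable (lebesgue_on {0..T}) f"
  using finite_measure.integrable_const_bound[OF finite_measure_lebesgue_on_Icc assms(2,1)] .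

lemma integrable_continuous_on_Icc:
  fixes f :: "real \<Rightarrow> 'b::{banach, second_countable_topology}"
  assumes "continuous_on {0..T} f"
  shows "integrable (lebesgue_on {0..T}) f"
proof -
  have "compact (f ` {0..T})" using assms by (intro compact_continuous_image) auto
  then obtain B where "\<And>x. x \<in> {0..T} \<Longrightarrow> norm (f x) \<le> B"
    using compact_imp_bounded bounded_iff[of "f ` {0..T}"] by (metis imageI)
  then show ?thesis
    using assms by (intro integrable_AE_bounded_Icc[where B = B] borel_measurable_continuous_on_Icc)
      (auto intro!: AE_I2)
qed

lemma restrict_space_lebesgue_on_Icc:
  assumes "(t::real) \<le> T"
  shows "restrict_space (lebesgue_on {0..T}) {0..t} = lebesgue_on {0..t}"
  using assms by (subst restrict_restrict_space) (auto intro!: arg_cong2[where f = restrict_space])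

lemma measurable_lebesgue_on_Icc_mono:
  assumes "f \<in> measurable (lebesgue_on {0..T}) N" "(t::real) \<le> T"
  shows "f \<in> measurable (lebesgue_on {0..t}) N"
  using measurable_restrict_space1[OF assms(1), of "{0..t}"] by (simp add: restrict_space_lebesgue_on_Icc assms(2))

lemma AE_lebesgue_on_Icc_mono:
  assumes "AE s in lebesgue_on {0..T}. Q s" "(t::real) \<le> T"
  shows "AE s in lebesgue_on {0..t}. Q s"
  using assms by (simp add: AE_restrict_space_iff) (elim AE_mp, auto)

text \<open>The negative boundary term at 0 is dropped. Multiplied by exp (- a t) the bound becomes
  1/a for all t, which is the source both of the contraction factor in the weighted norms and of the
  rate 1/lambda on the tail.\<close>

lemma integral_exp_Icc_le:
  fixes a t :: real
  assumes "a > 0" "t \<ge> 0"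
  shows "(LINT s|lebesgue_on {0..t}. exp (a * s)) \<le> exp (a * t) / a"
proof -
  have "((\<lambda>s. exp (a * s)) has_integral (exp (a * t) / a - exp (a * 0) / a)) {0..t}"
    using assms
    by (intro fundamental_theorem_of_calculus)
       (auto intro!: derivative_eq_intros simp flip: has_real_derivative_iff_has_vector_derivative)
  then have "integral {0..t} (\<lambda>s. exp (a * s)) \<le> exp (a * t) / a"
    using assms by (auto dest: integral_unique)
  moreover have "(LINT s|lebesgue_on {0..t}. exp (a * s)) = integral {0..t} (\<lambda>s. exp (a * s))"
    by (intro lebesgue_integral_eq_integral integrable_continuous_on_Icc continuous_intros) auto
  ultimately show ?thesis by simp
qed

text \<open>The proof uses the weighted supremum \<open>sup\<^sub>t exp (- a t) \<phi>(t)\<close>, with the weight chosen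
  so large that the integral operator halves it; the constant is not optimal.\<close>

lemma weighted_gronwall:
  fixes \<phi> :: "real \<Rightarrow> real"
  assumes T: "0 \<le> T" and K: "0 \<le> K" and \<phi>: "continuous_on {0..T} \<phi>" and \<epsilon>: "0 \<le> \<epsilon>"
    and le: "\<And>t. t \<in> {0..T} \<Longrightarrow> \<phi> t \<le> \<epsilon> + K * (LINT s|lebesgue_on {0..t}. \<phi> s)"
    and pos: "\<And>t. t \<in> {0..T} \<Longrightarrow> 0 \<le> \<phi> t"
    and t: "t \<in> {0..T}"
  shows "\<phi> t \<le> 2 * \<epsilon> * exp ((2 * K + 1) * T)"
proof -
  \<comment> \<open>The summand 1 keeps \<open>a\<close> positive when \<open>K = 0\<close>.\<close>
  define a where "a = 2 * K + 1"
  have a: "a > 0" "K \<le> a / 2" using K by (auto simp: a_def)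
  define \<psi> where "\<psi> s = exp (- (a * s)) * \<phi> s" for s
  have "continuous_on {0..T} \<psi>"
    unfolding \<psi>_def by (intro continuous_intros \<phi>)
  then obtain t0 where t0: "t0 \<in> {0..T}" "\<And>s. s \<in> {0..T} \<Longrightarrow> \<psi> s \<le> \<psi> t0"
    using continuous_attains_sup[of "{0..T}" \<psi>] T by auto
  have \<phi>_eq: "\<phi> s = \<psi> s * exp (a * s)" for s
    by (simp add: \<psi>_def exp_minus field_simps)
  have M: "0 \<le> \<psi> t0" using pos[OF t0(1)] by (simp add: \<psi>_def)
  have "(LINT s|lebesgue_on {0..t0}. \<phi> s) \<le> (LINT s|lebesgue_on {0..t0}. \<psi> t0 * exp (a * s))"
    using t0 by (intro integral_mono integrable_continuous_on_Icc continuous_intros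
        continuous_on_subset[OF \<phi>]) (auto simp: \<phi>_eq intro!: mult_right_mono)
  also have "\<dots> \<le> \<psi> t0 * (exp (a * t0) / a)"
    using a t0 M mult_left_mono[OF integral_exp_Icc_le[of a t0] M] by simp
  finally have "K * (LINT s|lebesgue_on {0..t0}. \<phi> s) \<le> K * (\<psi> t0 * (exp (a * t0) / a))"
    using K by (rule mult_left_mono)
  also have "\<dots> \<le> a / 2 * (\<psi> t0 * (exp (a * t0) / a))"
    using a M by (intro mult_right_mono) auto
  also have "\<dots> = \<phi> t0 / 2" using a by (simp add: \<phi>_eq)
  \<comment> \<open>At the maximum point \<open>t0\<close> the hypothesis reads \<phi> t0 \<le>
    \<epsilon> + \<phi> t0 / 2, and the half is absorbed on the left.\<close>
  finally have "\<phi> t0 \<le> 2 * \<epsilon>" using le[OF t0(1)] by linarith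
  then have "\<psi> t0 \<le> 1 * (2 * \<epsilon>)"
    unfolding \<psi>_def using a t0 \<epsilon> pos[OF t0(1)] by (intro mult_mono) auto
  with t0(2)[OF t] have "\<psi> t \<le> 2 * \<epsilon>" by simp
  then have "\<phi> t \<le> 2 * \<epsilon> * exp (a * t)"
    by (simp add: \<phi>_eq)
  also have "\<dots> \<le> 2 * \<epsilon> * exp (a * T)"
    using \<epsilon> t a by (intro mult_left_mono) auto
  finally show ?thesis by (simp add: a_def)
qed

section \<open>Contraction semigroups\<close>

locale contraction_sg =
  fixes P :: "real \<Rightarrow> 'h \<Rightarrow> 'h::{banach, second_countable_topology}"
  assumes sg: "contraction_semigroup P"
begin

lemma bounded_linear_P: "0 \<le> t \<Longrightarrow> bounded_linear (P t)"
  and norm_P_le: "0 \<le> t \<Longrightarrow> norm (P t x) \<le> norm x"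
  and P_zero [simp]: "P 0 x = x"
  and P_add: "0 \<le> s \<Longrightarrow> 0 \<le> t \<Longrightarrow> P (s + t) x = P s (P t x)"
  and P_tendsto: "((\<lambda>t. P t x) \<longlongrightarrow> x) (at_right 0)"
  using sg unfolding contraction_semigroup_def by blast+

lemma P_diff: "0 \<le> t \<Longrightarrow> P t (x - y) = P t x - P t y"
  by (intro linear_diff bounded_linear.linear bounded_linear_P)

text \<open>The smaller time factors out by the semigroup law and disappears by contractivity.
  Continuity of orbits is thereby reduced to time 0.\<close>

lemma norm_orbit_diff_le:
  assumes "0 \<le> s" "0 \<le> t"
  shows "norm (P s x - P t x) \<le> norm (P \<bar>s - t\<bar> x - x)"
proof -
  have *: "norm (P s x - P t x) \<le> norm (P (s - t) x - x)" if "0 \<le> t" "t \<le> s" for s t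
  proof -
    have "P s x - P t x = P t (P (s - t) x - x)"
      using P_add[of t "s - t" x] that by (simp add: P_diff)
    then show ?thesis using norm_P_le[OF that(1)] by metis
  qed
  show ?thesis
    using *[of t s] *[of s t] assms by (cases "t \<le> s") (auto simp: norm_minus_commute)
qed

text \<open>\<open>P\<close> is controlled only at nonnegative times; the even extension turns the
  right-hand limit at 0 into two-sided continuity on the whole line.\<close>

lemma isCont_orbit_zero: "isCont (\<lambda>r. P \<bar>r\<bar> x) 0"
  unfolding continuous_at_eps_delta
proof (intro allI impI)
  fix \<epsilon> :: real assume \<epsilon>: "\<epsilon> > 0"
  then obtain \<delta> where \<delta>: "\<delta> > 0" "\<And>t. 0 < t \<Longrightarrow> t < \<delta> \<Longrightarrow> dist (P t x) x < \<epsilon>"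
    using tendstoD[OF P_tendsto \<epsilon>, of x] unfolding eventually_at_right_field by blast
  have "dist (P \<bar>r\<bar> x) x < \<epsilon>" if "\<bar>r\<bar> < \<delta>" for r
    using \<delta>(2)[of "\<bar>r\<bar>"] that \<epsilon> by (cases "r = 0") auto
  then show "\<exists>\<delta>>0. \<forall>r. dist r 0 < \<delta> \<longrightarrow> dist (P \<bar>r\<bar> x) (P \<bar>0\<bar> x) < \<epsilon>"
    using \<delta>(1) by (auto simp: dist_real_def)
qed

text \<open>Strong continuity improves to joint continuity because the operators are uniformly
  bounded: split P(t) x - P(t0) x0 into P(t) (x - x0) and (P(t) - P(t0)) x0. Joint continuity is
  what makes P(t - s) g(s) measurable in s for merely measurable g.\<close>

lemma continuous_on_P_Pair: "continuous_on UNIV (\<lambda>z. P \<bar>fst z\<bar> (snd z))"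
  unfolding continuous_on_eq_continuous_at[OF open_UNIV]
proof
  fix z0 :: "real \<times> 'h"
  obtain t0 x0 where z0: "z0 = (t0, x0)" by fastforce
  have lims: "(fst \<longlongrightarrow> t0) (at z0)" "(snd \<longlongrightarrow> x0) (at z0)"
    using tendsto_fst[OF tendsto_ident_at] tendsto_snd[OF tendsto_ident_at] unfolding z0 by fastforce+
  have "((\<lambda>z. \<bar>fst z\<bar> - \<bar>t0\<bar>) \<longlongrightarrow> 0) (at z0)"
    by (auto simp: z0 intro!: tendsto_eq_intros lims[unfolded z0])
  then have "((\<lambda>z. P \<bar>\<bar>fst z\<bar> - \<bar>t0\<bar>\<bar> x0) \<longlongrightarrow> x0) (at z0)"
    using isCont_tendsto_compose[OF isCont_orbit_zero[of x0]] by fastforce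
  then have lim: "((\<lambda>z. norm (snd z - x0) + norm (P \<bar>\<bar>fst z\<bar> - \<bar>t0\<bar>\<bar> x0 - x0)) \<longlongrightarrow> 0) (at z0)"
    by (auto simp: z0 intro!: tendsto_eq_intros lims[unfolded z0])
  have bnd: "norm (P \<bar>fst z\<bar> (snd z) - P \<bar>t0\<bar> x0)
      \<le> norm (snd z - x0) + norm (P \<bar>\<bar>fst z\<bar> - \<bar>t0\<bar>\<bar> x0 - x0)" for z
  proof -
    have "P \<bar>fst z\<bar> (snd z) - P \<bar>t0\<bar> x0 = P \<bar>fst z\<bar> (snd z - x0) + (P \<bar>fst z\<bar> x0 - P \<bar>t0\<bar> x0)"
      by (simp add: P_diff)
    also have "norm \<dots> \<le> norm (P \<bar>fst z\<bar> (snd z - x0)) + norm (P \<bar>fst z\<bar> x0 - P \<bar>t0\<bar> x0)"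
      by (rule norm_triangle_ineq)
    also have "\<dots> \<le> norm (snd z - x0) + norm (P \<bar>\<bar>fst z\<bar> - \<bar>t0\<bar>\<bar> x0 - x0)"
      by (intro add_mono norm_P_le norm_orbit_diff_le) auto
    finally show ?thesis .
  qed
  have "((\<lambda>z. P \<bar>fst z\<bar> (snd z) - P \<bar>t0\<bar> x0) \<longlongrightarrow> 0) (at z0)"
    by (rule Lim_null_comparison[OF always_eventually[OF allI[OF bnd]] lim])
  then have "((\<lambda>z. P \<bar>fst z\<bar> (snd z)) \<longlongrightarrow> P \<bar>t0\<bar> x0) (at z0)"
    by (rule LIM_zero_cancel)
  then show "isCont (\<lambda>z. P \<bar>fst z\<bar> (snd z)) z0"
    by (simp add: isCont_def z0)
qed

lemma continuous_on_P_abs: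
  assumes "continuous_on S f" "continuous_on S g"
  shows "continuous_on S (\<lambda>s. P \<bar>f s\<bar> (g s))"
  using continuous_on_compose2[OF continuous_on_P_Pair continuous_on_Pair[OF assms]] by simp

lemma continuous_on_orbit: "continuous_on {0..T} (\<lambda>t. P t x)"
  using continuous_on_P_abs[of "{0..T}" "\<lambda>t. t" "\<lambda>_. x"]
  by (rule continuous_on_eq) (auto intro: continuous_intros)

subsection \<open>Convolution with the semigroup\<close>

definition convol :: "(real \<Rightarrow> 'h) \<Rightarrow> real \<Rightarrow> 'h" where
  "convol g t = (LINT s|lebesgue_on {0..t}. P (t - s) (g s))"

lemma borel_measurable_orbit:
  assumes "g \<in> borel_measurable (lebesgue_on {0..t})"
  shows "(\<lambda>s. P (t - s) (g s)) \<in> borel_measurable (lebesgue_on {0..t})"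
proof -
  have "(\<lambda>s. t - s) \<in> borel_measurable (lebesgue_on {0..t})"
    by (intro borel_measurable_continuous_on_Icc continuous_intros)
  then have "(\<lambda>s. P \<bar>t - s\<bar> (g s)) \<in> borel_measurable (lebesgue_on {0..t})"
    using assms continuous_on_P_Pair by (rule borel_measurable_continuous_Pair)
  then show ?thesis
    by (rule measurable_cong[THEN iffD1, rotated]) auto
qed

lemma integrable_orbit:
  assumes "g \<in> borel_measurable (lebesgue_on {0..T})" "AE s in lebesgue_on {0..T}. norm (g s) \<le> B"
    and t: "t \<le> T"
  shows "integrable (lebesgue_on {0..t}) (\<lambda>s. P (t - s) (g s))"
proof (rule integrable_AE_bounded_Icc)
  show "(\<lambda>s. P (t - s) (g s)) \<in> borel_measurable (lebesgue_on {0..t})"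
    by (intro borel_measurable_orbit measurable_lebesgue_on_Icc_mono[OF assms(1) t])
  show "AE s in lebesgue_on {0..t}. norm (P (t - s) (g s)) \<le> B"
    using AE_lebesgue_on_Icc_mono[OF assms(2) t] AE_space
    by eventually_elim (auto intro: order_trans[OF norm_P_le])
qed

lemma integrable_orbit_continuous:
  assumes "continuous_on {0..T} g" "t \<le> T"
  shows "integrable (lebesgue_on {0..t}) (\<lambda>s. P (t - s) (g s))"
proof -
  have "continuous_on {0..t} (\<lambda>s. P \<bar>t - s\<bar> (g s))"
    using assms by (intro continuous_on_P_abs continuous_intros) (auto elim: continuous_on_subset)
  then have "continuous_on {0..t} (\<lambda>s. P (t - s) (g s))"
    by (rule continuous_on_eq) auto
  then show ?thesis by (rule integrable_continuous_on_Icc)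
qed

text \<open>Since \<open>g\<close> is merely measurable and bounded, continuity in t comes from
  dominated convergence. The moving upper limit is encoded as an indicator on the fixed interval
  [0,T].\<close>

lemma continuous_on_convol:
  assumes g: "g \<in> borel_measurable (lebesgue_on {0..T})" "AE s in lebesgue_on {0..T}. norm (g s) \<le> B"
  shows "continuous_on {0..T} (convol g)"
proof -
  let ?M = "lebesgue_on {0..T}"
  define h where "h t s = indicator {0..t} s *\<^sub>R P \<bar>t - s\<bar> (g s)" for t s
  have Int: "{0..t} \<inter> space ?M \<in> sets ?M" for t
    by (auto simp: sets_restrict_space)
  have eq: "convol g t = (LINT s|?M. h t s)" if "t \<in> {0..T}" for t
  proof -
    have "convol g t = (LINT s|lebesgue_on {0..t}. P \<bar>t - s\<bar> (g s))"
      unfolding convol_def by (rule Bochner_Integration.integral_cong) auto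
    also have "\<dots> = (LINT s|restrict_space ?M {0..t}. P \<bar>t - s\<bar> (g s))"
      using that by (simp only: restrict_space_lebesgue_on_Icc atLeastAtMost_iff)
    also have "\<dots> = (LINT s|?M. h t s)"
      unfolding h_def by (rule integral_restrict_space[OF Int])
    finally show ?thesis .
  qed
  have meas: "h t \<in> borel_measurable ?M" for t
  proof -
    have "(\<lambda>s. t - s) \<in> borel_measurable ?M"
      by (intro borel_measurable_continuous_on_Icc continuous_intros)
    then have "(\<lambda>s. P \<bar>t - s\<bar> (g s)) \<in> borel_measurable ?M"
      using g(1) continuous_on_P_Pair by (rule borel_measurable_continuous_Pair)
    moreover have "(indicator {0..t} :: real \<Rightarrow> real) \<in> borel_measurable ?M"
      using Int by (simp only: borel_measurable_indicator_iff)
    ultimately show ?thesis unfolding h_def by (intro borel_measurable_scaleR)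
  qed
  show ?thesis
    unfolding continuous_on_sequentially
  proof (intro allI ballI impI)
    fix X a assume a: "a \<in> {0..T}" and X: "(\<forall>n. X n \<in> {0..T}) \<and> X \<longlonglongrightarrow> a"
    have "(\<lambda>n. LINT s|?M. h (X n) s) \<longlonglongrightarrow> (LINT s|?M. h a s)"
    proof (rule integral_dominated_convergence[where w = "\<lambda>_. B"])
      show "integrable ?M (\<lambda>_. B)" by (intro integrable_continuous_on_Icc continuous_intros)
      \<comment> \<open>Only at \<open>s = a\<close> can the indicators of [0, \<open>X n\<close>]
        fail to settle, and this single point is null.\<close>
      have "AE s in ?M. s \<noteq> a"
        by (rule AE_I'[of "{a}"]) (use a in \<open>auto simp: null_sets_restrict_space\<close>)
      then show "AE s in ?M. (\<lambda>n. h (X n) s) \<longlonglongrightarrow> h a s"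
      proof eventually_elim
        case (elim s)
        have "eventually (\<lambda>n. indicator {0..X n} s = (indicator {0..a} s :: real)) sequentially"
        proof (cases "s < a")
          case True
          then have "eventually (\<lambda>n. s < X n) sequentially"
            using X by (intro order_tendstoD(1)) auto
          then show ?thesis by (rule eventually_mono) (use True in \<open>auto simp: indicator_def\<close>)
        next
          case False
          then have "eventually (\<lambda>n. X n < s) sequentially"
            using X elim by (intro order_tendstoD(2)) auto
          then show ?thesis by (rule eventually_mono) (use False elim in \<open>auto simp: indicator_def\<close>)
        qed
        then have "(\<lambda>n. indicator {0..X n} s :: real) \<longlonglongrightarrow> indicator {0..a} s"
          by (intro tendsto_eventually)
        moreover have "(\<lambda>n. P \<bar>X n - s\<bar> (g s)) \<longlonglongrightarrow> P \<bar>a - s\<bar> (g s)"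
          using X by (intro continuous_on_tendsto_compose[where f = "\<lambda>r. P \<bar>r - s\<bar> (g s)" and s = UNIV]
              continuous_on_P_abs continuous_intros) auto
        ultimately show ?case unfolding h_def by (rule tendsto_scaleR)
      qed
      show "AE s in ?M. norm (h (X n) s) \<le> B" for n
        using g(2)
      proof eventually_elim
        case (elim s)
        have "norm (h (X n) s) \<le> norm (P \<bar>X n - s\<bar> (g s))"
          by (auto simp: h_def indicator_def)
        also have "\<dots> \<le> norm (g s)" by (rule norm_P_le) simp
        finally show ?case using elim by simp
      qed
    qed (use meas in auto)
    then show "(convol g \<circ> X) \<longlonglongrightarrow> convol g a"
      using X a by (simp add: eq comp_def)
  qed
qed

lemma continuous_on_convol_continuous:
  assumes g: "continuous_on {0..T} g"
  shows "continuous_on {0..T} (convol g)"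
proof -
  obtain B where "\<And>x. x \<in> {0..T} \<Longrightarrow> norm (g x) \<le> B"
    using compact_imp_bounded[OF compact_continuous_image[OF g]] bounded_iff[of "g ` {0..T}"]
    by (metis compact_Icc imageI)
  then show ?thesis
    by (intro continuous_on_convol[of _ _ B] borel_measurable_continuous_on_Icc[OF g]) (auto intro!: AE_I2)
qed

lemma norm_convol_le:
  assumes g: "integrable (lebesgue_on {0..t}) (\<lambda>s. P (t - s) (g s))"
    and \<phi>: "integrable (lebesgue_on {0..t}) \<phi>"
    and le: "AE s in lebesgue_on {0..t}. norm (g s) \<le> \<phi> s"
  shows "norm (convol g t) \<le> (LINT s|lebesgue_on {0..t}. \<phi> s)"
proof -
  have "norm (convol g t) \<le> (LINT s|lebesgue_on {0..t}. norm (P (t - s) (g s)))"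
    unfolding convol_def by (rule integral_norm_bound)
  also have "\<dots> \<le> (LINT s|lebesgue_on {0..t}. \<phi> s)"
  proof (rule integral_mono_AE)
    show "AE s in lebesgue_on {0..t}. norm (P (t - s) (g s)) \<le> \<phi> s"
      using le AE_space by eventually_elim (auto intro: order_trans[OF norm_P_le])
  qed (use g \<phi> in auto)
  finally show ?thesis .
qed

lemma convol_diff:
  assumes "integrable (lebesgue_on {0..t}) (\<lambda>s. P (t - s) (g s))"
    and "integrable (lebesgue_on {0..t}) (\<lambda>s. P (t - s) (h s))"
  shows "convol g t - convol h t = convol (\<lambda>s. g s - h s) t"
    and "integrable (lebesgue_on {0..t}) (\<lambda>s. P (t - s) (g s - h s))"
proof -
  have eq: "P (t - s) (g s - h s) = P (t - s) (g s) - P (t - s) (h s)" if "s \<in> space (lebesgue_on {0..t})" for s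
    using that by (intro P_diff) auto
  show "convol g t - convol h t = convol (\<lambda>s. g s - h s) t"
  proof -
    have "convol (\<lambda>s. g s - h s) t = (LINT s|lebesgue_on {0..t}. P (t - s) (g s) - P (t - s) (h s))"
      unfolding convol_def by (intro Bochner_Integration.integral_cong refl eq)
    then show ?thesis
      unfolding convol_def by (simp add: Bochner_Integration.integral_diff[OF assms])
  qed
  show "integrable (lebesgue_on {0..t}) (\<lambda>s. P (t - s) (g s - h s))"
    using Bochner_Integration.integrable_diff[OF assms]
    by (subst Bochner_Integration.integrable_cong[OF refl eq])
qed

end

section \<open>Well-posedness of the mild formulation\<close>

lemma integral_const_Icc:
  assumes "(0::real) \<le> t"
  shows "(LINT s|lebesgue_on {0..t}. (c::real)) = c * t"
  using assms by (simp add: measure_restrict_space)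

text \<open>The control enters only through the forcing \<open>g\<close>, the image of the control
  under \<open>C\<close>. The locale is instantiated for the full problem and for every Galerkin
  problem, with the same constants \<open>K\<close> and \<open>B\<close>.\<close>

locale mild_problem = contraction_sg P
  for P :: "real \<Rightarrow> 'h \<Rightarrow> 'h::{banach, second_countable_topology}" +
  fixes F :: "'h \<Rightarrow> 'h" and K :: real and g :: "real \<Rightarrow> 'h" and B T :: real
  assumes T_nonneg: "0 \<le> T"
    and lipschitz: "K-lipschitz_on UNIV F"
    and g_measurable: "g \<in> borel_measurable (lebesgue_on {0..T})"
    and g_bounded: "AE s in lebesgue_on {0..T}. norm (g s) \<le> B"
    and B_nonneg: "0 \<le> B"
begin

definition solves :: "'h \<Rightarrow> (real \<Rightarrow> 'h) \<Rightarrow> bool" where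
  "solves x y \<longleftrightarrow> continuous_on {0..T} y \<and>
     (\<forall>t\<in>{0..T}. y t = P t x + convol (\<lambda>s. F (y s)) t + convol g t)"

lemma K_nonneg: "0 \<le> K"
  using lipschitz by (rule lipschitz_on_nonneg)

lemma norm_F_diff_le: "norm (F y - F z) \<le> K * norm (y - z)"
  using lipschitz_onD[OF lipschitz, of y z] by (simp add: dist_norm)

lemma continuous_on_F: "continuous_on S y \<Longrightarrow> continuous_on S (\<lambda>s. F (y s))"
  using lipschitz_on_continuous_on[OF lipschitz] by (rule continuous_on_compose2) auto

text \<open>Both integrands are integrable automatically, by continuity of \<open>y\<close> and by
  the bound on \<open>g\<close>. What remains is the equation, continuity and the convention outside
  [0,T].\<close>

lemma voc_solution_iff_solves:
  assumes "g = (\<lambda>s. C (u s))"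
  shows "voc_solution P F C T UNIV x u y \<longleftrightarrow> y \<in> extensional {0..T} \<and> solves x y"
proof -
  have "C (u s) = g s" for s by (simp add: assms)
  then show ?thesis
    using integrable_orbit[OF g_measurable g_bounded] integrable_orbit_continuous[OF continuous_on_F]
    by (auto simp: voc_solution_def C_paths_def solves_def convol_def)
qed

text \<open>The common estimate behind uniqueness, the fixed point contraction and the Galerkin
  error; hence it is stated for arbitrary continuous functions instead of solutions.\<close>

lemma norm_convol_F_diff_le:
  assumes y: "continuous_on {0..T} y" and z: "continuous_on {0..T} z" and t: "t \<in> {0..T}"
  shows "norm (convol (\<lambda>s. F (y s)) t - convol (\<lambda>s. F (z s)) t)
    \<le> K * (LINT s|lebesgue_on {0..t}. norm (y s - z s))"
proof -
  note int = integrable_orbit_continuous[OF continuous_on_F[OF y], of t]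
    integrable_orbit_continuous[OF continuous_on_F[OF z], of t]
  have "norm (convol (\<lambda>s. F (y s)) t - convol (\<lambda>s. F (z s)) t)
      = norm (convol (\<lambda>s. F (y s) - F (z s)) t)"
    using t by (subst convol_diff) (auto intro!: int)
  also have "\<dots> \<le> (LINT s|lebesgue_on {0..t}. K * norm (y s - z s))"
  proof (rule norm_convol_le)
    show "integrable (lebesgue_on {0..t}) (\<lambda>s. P (t - s) (F (y s) - F (z s)))"
      using t by (intro convol_diff(2) int) auto
    show "integrable (lebesgue_on {0..t}) (\<lambda>s. K * norm (y s - z s))"
      using t by (intro integrable_continuous_on_Icc continuous_intros
          continuous_on_subset[OF y] continuous_on_subset[OF z]) auto
  qed (simp add: norm_F_diff_le)
  finally show ?thesis by simp
qed

text \<open>In the difference of two solutions the initial datum and the forcing cancel, so Gronwall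
  applies with \<epsilon> = 0.\<close>

lemma solves_unique:
  assumes y: "solves x y" and z: "solves x z" and t: "t \<in> {0..T}"
  shows "y t = z t"
proof -
  have c: "continuous_on {0..T} y" "continuous_on {0..T} z"
    using y z by (auto simp: solves_def)
  have "norm (y t - z t) \<le> 2 * 0 * exp ((2 * K + 1) * T)"
  proof (rule weighted_gronwall[OF T_nonneg K_nonneg _ order_refl _ _ t, of "\<lambda>t. norm (y t - z t)"])
    show "continuous_on {0..T} (\<lambda>t. norm (y t - z t))"
      by (intro continuous_intros c)
    fix t assume t: "t \<in> {0..T}"
    have "y t - z t = convol (\<lambda>s. F (y s)) t - convol (\<lambda>s. F (z s)) t"
      using y z t by (simp add: solves_def)
    then show "norm (y t - z t) \<le> 0 + K * (LINT s|lebesgue_on {0..t}. norm (y s - z s))"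
      using norm_convol_F_diff_le[OF c t] by simp
  qed simp
  then show ?thesis by simp
qed

text \<open>A priori bound by Gronwall, using linear growth of \<open>F\<close>. It depends on the
  forcing only through \<open>B\<close>, so it is uniform over all controls sharing that
  bound.\<close>

lemma solves_bound:
  assumes y: "solves x y" and t: "t \<in> {0..T}"
  shows "norm (y t) \<le> 2 * (norm x + (norm (F 0) + B) * T) * exp ((2 * K + 1) * T)"
proof (rule weighted_gronwall[OF T_nonneg K_nonneg _ _ _ _ t, of "\<lambda>t. norm (y t)"])
  have c: "continuous_on {0..T} y" using y by (simp add: solves_def)
  then show "continuous_on {0..T} (\<lambda>t. norm (y t))" by (intro continuous_intros)
  show "0 \<le> norm x + (norm (F 0) + B) * T"
    using T_nonneg B_nonneg by auto
  fix t assume t: "t \<in> {0..T}"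
  have "norm (convol (\<lambda>s. F (y s)) t) \<le> (LINT s|lebesgue_on {0..t}. norm (F 0) + K * norm (y s))"
  proof (rule norm_convol_le)
    show "integrable (lebesgue_on {0..t}) (\<lambda>s. P (t - s) (F (y s)))"
      using t by (intro integrable_orbit_continuous[OF continuous_on_F[OF c]]) auto
    show "integrable (lebesgue_on {0..t}) (\<lambda>s. norm (F 0) + K * norm (y s))"
      using t by (intro integrable_continuous_on_Icc continuous_intros continuous_on_subset[OF c]) auto
    have "norm (F (y s)) \<le> norm (F 0) + K * norm (y s)" for s
      using norm_F_diff_le[of "y s" 0] norm_triangle_ineq2[of "F (y s)" "F 0"] by simp
    then show "AE s in lebesgue_on {0..t}. norm (F (y s)) \<le> norm (F 0) + K * norm (y s)"
      by simp
  qed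
  also have "\<dots> = (LINT s|lebesgue_on {0..t}. norm (F 0)) + (LINT s|lebesgue_on {0..t}. K * norm (y s))"
    using t by (intro Bochner_Integration.integral_add integrable_continuous_on_Icc continuous_intros
        continuous_on_subset[OF c]) auto
  also have "\<dots> = norm (F 0) * t + K * (LINT s|lebesgue_on {0..t}. norm (y s))"
    using t by (subst integral_const_Icc) auto
  finally have 1: "norm (convol (\<lambda>s. F (y s)) t) \<le> norm (F 0) * t + K * (LINT s|lebesgue_on {0..t}. norm (y s))" .
  have "norm (convol g t) \<le> (LINT s|lebesgue_on {0..t}. B)"
    using t by (intro norm_convol_le integrable_orbit[OF g_measurable g_bounded]
        integrable_continuous_on_Icc continuous_intros AE_lebesgue_on_Icc_mono[OF g_bounded]) auto
  also have "\<dots> = B * t"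
    using t by (intro integral_const_Icc) auto
  finally have 2: "norm (convol g t) \<le> B * t" .
  have "norm (y t) \<le> norm (P t x) + norm (convol (\<lambda>s. F (y s)) t) + norm (convol g t)"
    using y t unfolding solves_def by (metis norm_triangle_le norm_triangle_ineq add_mono order_refl)
  also have "\<dots> \<le> norm x + (norm (F 0) * t + K * (LINT s|lebesgue_on {0..t}. norm (y s))) + B * t"
    using t by (intro add_mono 1 2 norm_P_le) auto
  also have "\<dots> = norm x + (norm (F 0) + B) * t + K * (LINT s|lebesgue_on {0..t}. norm (y s))"
    by (simp add: algebra_simps)
  \<comment> \<open>Enlarging \<open>t\<close> to \<open>T\<close> makes the inhomogeneous term
    constant, as the Gronwall lemma requires.\<close>
  also have "\<dots> \<le> norm x + (norm (F 0) + B) * T + K * (LINT s|lebesgue_on {0..t}. norm (y s))"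
    using t B_nonneg by (intro add_mono mult_left_mono order_refl) auto
  finally show "norm (y t) \<le> norm x + (norm (F 0) + B) * T + K * (LINT s|lebesgue_on {0..t}. norm (y s))" .
qed simp

text \<open>Banach's fixed point theorem for \<open>z(t) = exp (- a t) y(t)\<close>, extended constantly outside \<open>[0,T]\<close>.\<close>

lemma solves_exists: "\<exists>y. solves x y"
proof -
  define a where "a = 2 * K + 1"
  have a: "a > 0" "K \<le> a / 2" using K_nonneg by (auto simp: a_def)
  define \<tau> where "\<tau> t = max 0 (min T t)" for t
  have \<tau>: "\<tau> t \<in> {0..T}" for t using T_nonneg by (auto simp: \<tau>_def)
  have \<tau>_id: "\<tau> t = t" if "t \<in> {0..T}" for t using that by (auto simp: \<tau>_def)
  \<comment> \<open>\<open>w z\<close> undoes the weight: the ordinary supremum distance of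
    \<open>z\<close> and \<open>z'\<close> is the weighted distance of \<open>w z\<close> and
    \<open>w z'\<close>. The map \<open>R\<close> below is the right-hand side of the equation in
    the weighted variable.\<close>
  define w where "w z s = exp (a * s) *\<^sub>R apply_bcontfun z s" for z :: "real \<Rightarrow>\<^sub>C 'h" and s
  have w: "continuous_on S (w z)" for z S
    unfolding w_def by (intro continuous_intros continuous_on_apply_bcontfun)
  define R where "R z t = exp (- (a * t)) *\<^sub>R (P t x + convol (\<lambda>s. F (w z s)) t + convol g t)" for z t
  have R: "continuous_on {0..T} (R z)" for z
    unfolding R_def
    by (intro continuous_intros continuous_on_orbit continuous_on_convol[OF g_measurable g_bounded]
        continuous_on_convol_continuous continuous_on_F w)
  have "(\<lambda>t. R z (\<tau> t)) \<in> bcontfun" for z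
    unfolding bcontfun_def mem_Collect_eq
  proof
    show "continuous_on UNIV (\<lambda>t. R z (\<tau> t))"
      by (rule continuous_on_compose2[OF R]) (use \<tau> in \<open>auto simp: \<tau>_def intro!: continuous_intros\<close>)
    show "bounded (range (\<lambda>t. R z (\<tau> t)))"
      by (rule bounded_subset[OF compact_imp_bounded[OF compact_continuous_image[OF R]]]) (use \<tau> in auto)
  qed
  then have \<Psi>: "apply_bcontfun (Bcontfun (\<lambda>t. R z (\<tau> t))) t = R z (\<tau> t)" for z t
    by (simp add: Bcontfun_inverse)
  have contr: "norm (R z t - R z' t) \<le> 1 / 2 * dist z z'" if t: "t \<in> {0..T}" for z z' t
  proof -
    have "(LINT s|lebesgue_on {0..t}. norm (w z s - w z' s))
        \<le> (LINT s|lebesgue_on {0..t}. dist z z' * exp (a * s))"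
    proof (intro integral_mono integrable_continuous_on_Icc continuous_intros w)
      fix s
      have "norm (w z s - w z' s) = exp (a * s) * dist (z s) (z' s)"
        by (simp add: w_def dist_norm flip: scaleR_diff_right)
      then show "norm (w z s - w z' s) \<le> dist z z' * exp (a * s)"
        using dist_bounded[of z s z'] by (simp add: mult.commute)
    qed
    also have "\<dots> = dist z z' * (LINT s|lebesgue_on {0..t}. exp (a * s))" by simp
    also have "\<dots> \<le> dist z z' * (exp (a * t) / a)"
      using a t by (intro mult_left_mono integral_exp_Icc_le) auto
    finally have I: "(LINT s|lebesgue_on {0..t}. norm (w z s - w z' s)) \<le> dist z z' * (exp (a * t) / a)" .
    have "R z t - R z' t = exp (- (a * t)) *\<^sub>R (convol (\<lambda>s. F (w z s)) t - convol (\<lambda>s. F (w z' s)) t)"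
      by (simp add: R_def flip: scaleR_diff_right)
    then have "norm (R z t - R z' t)
        = exp (- (a * t)) * norm (convol (\<lambda>s. F (w z s)) t - convol (\<lambda>s. F (w z' s)) t)"
      by simp
    also have "\<dots> \<le> exp (- (a * t)) * (K * (LINT s|lebesgue_on {0..t}. norm (w z s - w z' s)))"
      by (intro mult_left_mono norm_convol_F_diff_le w t) auto
    \<comment> \<open>Here K \<le> a/2 enters; the factors a and exp (a t) then cancel and leave the
      contraction constant 1/2.\<close>
    also have "\<dots> \<le> exp (- (a * t)) * (a / 2 * (dist z z' * (exp (a * t) / a)))"
      using a K_nonneg I by (intro mult_left_mono mult_mono integral_nonneg_AE) auto
    also have "\<dots> = 1 / 2 * dist z z'"
      using a by (simp add: exp_minus field_simps)
    finally show ?thesis .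
  qed
  have "\<exists>!z. Bcontfun (\<lambda>t. R z (\<tau> t)) = z"
  proof (rule banach_fix_type[where c = "1 / 2"])
    show "\<forall>z z'. dist (Bcontfun (\<lambda>t. R z (\<tau> t))) (Bcontfun (\<lambda>t. R z' (\<tau> t))) \<le> 1 / 2 * dist z z'"
      by (intro allI dist_bound) (unfold \<Psi> dist_norm[of "R _ _"], intro contr \<tau>)
  qed auto
  then obtain z where z: "Bcontfun (\<lambda>t. R z (\<tau> t)) = z" by blast
  have "w z t = P t x + convol (\<lambda>s. F (w z s)) t + convol g t" if "t \<in> {0..T}" for t
  proof -
    have "z t = R z t" using \<Psi>[of z t] \<tau>_id[OF that] z by simp
    then show ?thesis by (simp add: w_def[of z t] R_def flip: exp_add)
  qed
  then show ?thesis
    using w unfolding solves_def by (intro exI[of _ "w z"]) blast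
qed

lemma ex1_solves: "\<exists>!y. y \<in> extensional {0..T} \<and> solves x y"
proof -
  obtain y where y: "solves x y" using solves_exists by blast
  show ?thesis
  proof (rule ex1I[of _ "restrict y {0..T}"])
    \<comment> \<open>The convolution at time \<open>t\<close> reads its argument only on [0,t], so
      restricting to [0,T] preserves the equation.\<close>
    have "convol (\<lambda>s. F (restrict y {0..T} s)) t = convol (\<lambda>s. F (y s)) t" if "t \<in> {0..T}" for t
      unfolding convol_def using that by (intro Bochner_Integration.integral_cong) auto
    moreover have "continuous_on {0..T} (restrict y {0..T})"
      using y unfolding solves_def by (subst continuous_on_cong[OF refl, of _ _ y]) auto
    ultimately have *: "solves x (restrict y {0..T})"
      using y by (auto simp: solves_def)
    then show "restrict y {0..T} \<in> extensional {0..T} \<and> solves x (restrict y {0..T})" by simp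
    fix z assume "z \<in> extensional {0..T} \<and> solves x z"
    then show "z = restrict y {0..T}"
      using solves_unique[OF _ *] by (intro extensionalityI[of _ "{0..T}"]) auto
  qed
qed

end

section \<open>Spectral decomposition of the semigroup and Galerkin projections\<close>

text \<open>With \<open>h = t/m\<close> and \<open>c = exp (- l h)\<close>, contractivity makes the errors
  \<open>P(h) v - c v = o(h)\<close> in the telescoping sum for \<open>P(h)\<^sup>m v - c\<^sup>m v\<close> merely add up.\<close>

lemma (in contraction_sg) P_eigenvector:
  assumes lim: "((\<lambda>h. (P h v - v) /\<^sub>R h) \<longlongrightarrow> - (l *\<^sub>R v)) (at_right 0)"
    and l: "0 \<le> l" and t: "0 \<le> t"
  shows "P t v = exp (- (l * t)) *\<^sub>R v"
proof (cases "t = 0")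
  case False
  with t have t: "t > 0" by simp
  define d where "d h = norm (P h v - exp (- (l * h)) *\<^sub>R v)" for h
  have "((\<lambda>h. (exp (- (l * h)) - 1) / h) \<longlongrightarrow> - l) (at_right 0)"
  proof -
    have "((\<lambda>h. exp (- (l * h))) has_real_derivative - l) (at 0)"
      by (auto intro!: derivative_eq_intros)
    then show ?thesis
      by (auto simp: DERIV_def intro: filterlim_mono at_le)
  qed
  \<comment> \<open>The difference quotients of P(h) v and of exp (- l h) v have the same limit - l
    v, so d(h)/h tends to 0.\<close>
  then have "((\<lambda>h. norm ((P h v - v) /\<^sub>R h - ((exp (- (l * h)) - 1) / h) *\<^sub>R v)) \<longlongrightarrow> norm (- (l *\<^sub>R v) - (- l) *\<^sub>R v)) (at_right 0)"
    by (intro tendsto_intros lim)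
  moreover have "norm ((P h v - v) /\<^sub>R h - ((exp (- (l * h)) - 1) / h) *\<^sub>R v) = d h / h" if "h > 0" for h
  proof -
    have "(P h v - v) /\<^sub>R h - ((exp (- (l * h)) - 1) / h) *\<^sub>R v = (P h v - exp (- (l * h)) *\<^sub>R v) /\<^sub>R h"
      using that by (simp add: algebra_simps divide_inverse)
    then show ?thesis using that by (simp add: d_def divide_inverse)
  qed
  ultimately have dlim: "((\<lambda>h. d h / h) \<longlongrightarrow> 0) (at_right 0)"
    by (subst (asm) tendsto_cong[where g = "\<lambda>h. d h / h"]) (auto simp: eventually_at_right_less eventually_at_right_field intro: exI[of _ 1])
  have step: "norm (P (real m * h) v - exp (- (l * h)) ^ m *\<^sub>R v) \<le> real m * d h" if h: "h \<ge> 0" for m h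
  proof (induction m)
    case (Suc m)
    let ?c = "exp (- (l * h))"
    have "P (real (Suc m) * h) v - ?c ^ Suc m *\<^sub>R v
        = P h (P (real m * h) v - ?c ^ m *\<^sub>R v) + ?c ^ m *\<^sub>R (P h v - ?c *\<^sub>R v)"
      using P_add[of h "real m * h" v] h linear_scale[OF bounded_linear.linear[OF bounded_linear_P[OF h]]]
      by (simp add: P_diff algebra_simps)
    then have "norm (P (real (Suc m) * h) v - ?c ^ Suc m *\<^sub>R v)
        \<le> norm (P h (P (real m * h) v - ?c ^ m *\<^sub>R v)) + norm (?c ^ m *\<^sub>R (P h v - ?c *\<^sub>R v))"
      by (metis norm_triangle_ineq)
    also have "\<dots> \<le> real m * d h + 1 * d h"
    proof (rule add_mono)
      show "norm (P h (P (real m * h) v - ?c ^ m *\<^sub>R v)) \<le> real m * d h"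
        using norm_P_le[OF h] Suc.IH by (rule order_trans)
      have "?c ^ m \<le> 1" using l h by (intro power_le_one) auto
      then show "norm (?c ^ m *\<^sub>R (P h v - ?c *\<^sub>R v)) \<le> 1 * d h"
        unfolding d_def norm_scaleR by (intro mult_right_mono) auto
    qed
    finally show ?case by (simp add: algebra_simps)
  qed simp
  \<comment> \<open>The number of time steps is \<open>Suc m\<close> to avoid division by zero. With
    h = t / \<open>Suc m\<close> the accumulated error is \<open>Suc m\<close> times d(h), that is t
    d(h)/h.\<close>
  have "filterlim (\<lambda>m. t / real (Suc m)) (at_right 0) sequentially"
    unfolding filterlim_at using t
    by (auto intro!: real_tendsto_divide_at_top filterlim_compose[OF filterlim_real_sequentially filterlim_Suc]
        always_eventually simp del: of_nat_Suc)
  from filterlim_compose[OF dlim this]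
  have "(\<lambda>m. t * (d (t / real (Suc m)) / (t / real (Suc m)))) \<longlonglongrightarrow> t * 0"
    by (intro tendsto_mult_left)
  moreover have "norm (P t v - exp (- (l * t)) *\<^sub>R v) \<le> t * (d (t / real (Suc m)) / (t / real (Suc m)))" for m
  proof -
    have "exp (- (l * (t / real (Suc m)))) ^ Suc m = exp (- (l * t))"
      by (simp flip: exp_of_nat_mult del: power_Suc of_nat_Suc)
    then show ?thesis
      using step[of "t / real (Suc m)" "Suc m"] t by (simp del: power_Suc of_nat_Suc add: mult.commute)
  qed
  ultimately have "norm (P t v - exp (- (l * t)) *\<^sub>R v) \<le> t * 0"
    by (intro LIMSEQ_le_const[where X = "\<lambda>m. t * (d (t / real (Suc m)) / (t / real (Suc m)))"]) auto
  then show ?thesis by simp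
qed simp

text \<open>Linearity of \<open>A\<close> is read off from the difference quotients, which are
  linear in the vector. Since \<open>generates\<close> is an equivalence, convergence for the sum
  gives both its membership in \<open>D\<close> and the value of \<open>A\<close> there.\<close>

lemma (in contraction_sg) generator_sum:
  assumes gen: "generates D A P" and x: "\<And>k. k \<in> S \<Longrightarrow> x k \<in> D"
  shows "A (\<Sum>k\<in>S. c k *\<^sub>R x k) = (\<Sum>k\<in>S. c k *\<^sub>R A (x k))"
proof -
  have "((\<lambda>h. \<Sum>k\<in>S. c k *\<^sub>R ((P h (x k) - x k) /\<^sub>R h)) \<longlongrightarrow> (\<Sum>k\<in>S. c k *\<^sub>R A (x k))) (at_right 0)"
    using gen x unfolding generates_def by (intro tendsto_sum tendsto_scaleR tendsto_const) blast
  moreover have "(\<Sum>k\<in>S. c k *\<^sub>R ((P h (x k) - x k) /\<^sub>R h))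
      = (P h (\<Sum>k\<in>S. c k *\<^sub>R x k) - (\<Sum>k\<in>S. c k *\<^sub>R x k)) /\<^sub>R h" if "h > 0" for h
  proof -
    interpret bounded_linear "P h" using that by (intro bounded_linear_P) simp
    show ?thesis
      by (simp add: sum scaleR sum_subtractf scaleR_diff_right scaleR_sum_right mult.commute)
  qed
  ultimately have "((\<lambda>h. (P h (\<Sum>k\<in>S. c k *\<^sub>R x k) - (\<Sum>k\<in>S. c k *\<^sub>R x k)) /\<^sub>R h)
      \<longlongrightarrow> (\<Sum>k\<in>S. c k *\<^sub>R A (x k))) (at_right 0)"
    by (subst (asm) tendsto_cong[where g = "\<lambda>h. (P h (\<Sum>k\<in>S. c k *\<^sub>R x k) - (\<Sum>k\<in>S. c k *\<^sub>R x k)) /\<^sub>R h"])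
       (auto simp: eventually_at_right_field intro: exI[of _ 1])
  then show ?thesis using gen unfolding generates_def by metis
qed

section \<open>Fourier projections and diagonal semigroups\<close>

lemma orth_proj_eqI:
  assumes Y: "subspace Y" and p: "p \<in> Y" "\<And>z. z \<in> Y \<Longrightarrow> (x - p) \<bullet> z = 0"
  shows "orth_proj Y x = p"
  unfolding orth_proj_def
proof (rule the_equality)
  fix p' assume p': "p' \<in> Y \<and> (\<forall>z\<in>Y. (x - p') \<bullet> z = 0)"
  then have z: "p' - p \<in> Y" using Y p by (auto intro: subspace_diff)
  have "(p' - p) \<bullet> (p' - p) = (x - p) \<bullet> (p' - p) - (x - p') \<bullet> (p' - p)"
    by (simp add: inner_diff_left)
  also have "\<dots> = 0" using p' p z by simp
  finally show "p' = p" by simp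
qed (use p in blast)

text \<open>The geometry of the sphere is reduced to a total orthonormal sequence on which the
  semigroup is diagonal.\<close>

locale spectral_semigroup = contraction_sg P
  for P :: "real \<Rightarrow> 'h \<Rightarrow> 'h::{real_inner, banach, second_countable_topology}" +
  fixes e :: "nat \<Rightarrow> 'h" and lam :: "nat \<Rightarrow> real"
  assumes P_e: "1 \<le> k \<Longrightarrow> 0 \<le> t \<Longrightarrow> P t (e k) = exp (- (lam k * t)) *\<^sub>R e k"
    and orthonormal: "1 \<le> j \<Longrightarrow> 1 \<le> k \<Longrightarrow> e j \<bullet> e k = (if j = k then 1 else 0)"
    and total: "closure (span (e ` {1..})) = UNIV"
    and lam_mono: "mono_on {1..} lam"
begin

lemma inner_sum_e:
  assumes "finite S" "S \<subseteq> {1..}" "1 \<le> k"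
  shows "(\<Sum>j\<in>S. c j *\<^sub>R e j) \<bullet> e k = (if k \<in> S then c k else 0)"
proof -
  have "(\<Sum>j\<in>S. c j *\<^sub>R e j) \<bullet> e k = (\<Sum>j\<in>S. if j = k then c j else 0)"
    unfolding inner_sum_left using assms(2,3) by (intro sum.cong) (auto simp: orthonormal)
  then show ?thesis using assms(1) by (simp add: sum.delta)
qed

lemma norm_sum_e:
  assumes "finite S" "S \<subseteq> {1..}"
  shows "(norm (\<Sum>k\<in>S. c k *\<^sub>R e k))\<^sup>2 = (\<Sum>k\<in>S. (c k)\<^sup>2)"
proof -
  have "(\<Sum>j\<in>S. c j *\<^sub>R e j) \<bullet> (\<Sum>k\<in>S. c k *\<^sub>R e k) = (\<Sum>k\<in>S. c k * c k)"
    unfolding inner_sum_right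
  proof (rule sum.cong)
    fix k assume k: "k \<in> S"
    then have "1 \<le> k" using assms(2) by auto
    then show "(\<Sum>j\<in>S. c j *\<^sub>R e j) \<bullet> (c k *\<^sub>R e k) = c k * c k"
      using k by (simp only: inner_scaleR_right inner_sum_e[OF assms] if_True)
  qed simp
  then show ?thesis by (simp only: power2_norm_eq_inner power2_eq_square[of "c _"])
qed

lemma P_sum_e:
  assumes "S \<subseteq> {1..}" "0 \<le> t"
  shows "P t (\<Sum>k\<in>S. c k *\<^sub>R e k) = (\<Sum>k\<in>S. (exp (- (lam k * t)) * c k) *\<^sub>R e k)"
proof -
  interpret bounded_linear "P t" by (rule bounded_linear_P[OF assms(2)])
  show ?thesis
    unfolding sum scaleR using assms by (intro sum.cong) (auto simp: P_e)
qed

text \<open>The residual of the Fourier partial sum is orthogonal to each of the first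
  \<open>N\<close> basis vectors, hence to their span. This replaces the implicit description of the
  projector by a formula.\<close>

lemma galerkin_proj_eq: "galerkin_proj e N x = (\<Sum>k=1..N. (x \<bullet> e k) *\<^sub>R e k)"
  unfolding galerkin_proj_def
proof (rule orth_proj_eqI)
  show "subspace (galerkin_space e N)"
    by (simp add: galerkin_space_def)
  show "(\<Sum>k=1..N. (x \<bullet> e k) *\<^sub>R e k) \<in> galerkin_space e N"
    unfolding galerkin_space_def by (intro span_sum span_scale span_base imageI)
  fix z assume "z \<in> galerkin_space e N"
  then show "(x - (\<Sum>k=1..N. (x \<bullet> e k) *\<^sub>R e k)) \<bullet> z = 0"
    unfolding galerkin_space_def
  proof (induction rule: span_induct_alt)
    case (step c v z)
    then obtain k where "k \<in> {1..N}" "v = e k" by blast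
    then show ?case
      using step(2) by (simp add: inner_add_right inner_diff_left inner_sum_e)
  qed simp
qed

lemma galerkin_proj_in_space: "galerkin_proj e N x \<in> galerkin_space e N"
  unfolding galerkin_proj_eq galerkin_space_def by (intro span_sum span_scale span_base imageI)

lemma galerkin_proj_sum_e:
  "galerkin_proj e N (\<Sum>k=1..N. c k *\<^sub>R e k) = (\<Sum>k=1..N. c k *\<^sub>R e k)"
  unfolding galerkin_proj_eq by (intro sum.cong refl) (simp add: inner_sum_e)

lemma galerkin_proj_add: "galerkin_proj e N (x + y) = galerkin_proj e N x + galerkin_proj e N y"
  by (simp add: galerkin_proj_eq inner_add_left scaleR_add_left sum.distrib)

lemma galerkin_proj_scale: "galerkin_proj e N (c *\<^sub>R x) = c *\<^sub>R galerkin_proj e N x"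
  by (simp add: galerkin_proj_eq scaleR_sum_right)

lemma norm_galerkin_proj_pythagoras:
  "(norm x)\<^sup>2 = (norm (galerkin_proj e N x))\<^sup>2 + (norm (x - galerkin_proj e N x))\<^sup>2"
proof -
  have commute: "e k \<bullet> x = x \<bullet> e k" for k
    by (rule inner_commute)
  have "galerkin_proj e N x \<bullet> galerkin_proj e N x = galerkin_proj e N x \<bullet> x"
    unfolding galerkin_proj_eq[of N x] inner_sum_right inner_sum_left[of _ _ x]
    by (intro sum.cong refl) (simp add: inner_sum_e commute)
  then show ?thesis
    by (simp add: power2_norm_eq_inner inner_diff_left inner_diff_right inner_commute)
qed

lemma norm_galerkin_proj_le: "norm (galerkin_proj e N x) \<le> norm x"
  and norm_galerkin_proj_compl_le: "norm (x - galerkin_proj e N x) \<le> norm x"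
  using norm_galerkin_proj_pythagoras[of x N] by (auto intro: power2_le_imp_le)

lemma bounded_linear_galerkin_proj: "bounded_linear (galerkin_proj e N)"
  by (rule bounded_linear_intro[where K = 1])
     (auto simp: galerkin_proj_add galerkin_proj_scale norm_galerkin_proj_le)

text \<open>Each vector of the dense span is eventually fixed by the projectors. As the
  complementary projectors are contractions, the approximation error of such a vector bounds the
  projection error of x.\<close>

lemma galerkin_proj_tendsto: "(\<lambda>N. galerkin_proj e N x) \<longlonglongrightarrow> x"
proof (rule LIMSEQ_I)
  fix \<epsilon> :: real assume "0 < \<epsilon>"
  then obtain y where y: "y \<in> span (e ` {1..})" "norm (x - y) < \<epsilon>"
    using total closure_approachable[of x "span (e ` {1..})"] by (auto simp: dist_norm norm_minus_commute)
  from y(1) have "\<exists>N0. \<forall>N\<ge>N0. galerkin_proj e N y = y"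
  proof (induction rule: span_induct_alt)
    case base
    then show ?case by (auto simp: galerkin_proj_eq)
  next
    case (step c v z)
    then obtain k N0 where k: "1 \<le> k" "v = e k" and N0: "\<And>N. N \<ge> N0 \<Longrightarrow> galerkin_proj e N z = z" by auto
    have "galerkin_proj e N (c *\<^sub>R v + z) = c *\<^sub>R v + z" if "N \<ge> max k N0" for N
    proof -
      have "galerkin_proj e N (e k) = (\<Sum>j=1..N. if j = k then e j else 0)"
        unfolding galerkin_proj_eq using k by (intro sum.cong) (auto simp: orthonormal)
      also have "\<dots> = e k" using k that by (simp add: sum.delta)
      finally show ?thesis using that k N0 by (simp add: galerkin_proj_add galerkin_proj_scale)
    qed
    then show ?case by blast
  qed
  then obtain N0 where N0: "\<And>N. N \<ge> N0 \<Longrightarrow> galerkin_proj e N y = y" by blast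
  have "norm (galerkin_proj e N x - x) < \<epsilon>" if "N \<ge> N0" for N
  proof -
    have "norm (galerkin_proj e N x - x) = norm ((x - y) - galerkin_proj e N (x - y))"
      using N0[OF that] linear_diff[OF bounded_linear.linear[OF bounded_linear_galerkin_proj[of N]], of x y]
      by (simp add: norm_minus_commute)
    also have "\<dots> \<le> norm (x - y)" by (rule norm_galerkin_proj_compl_le)
    finally show ?thesis using y by simp
  qed
  then show "\<exists>N0. \<forall>N\<ge>N0. norm (galerkin_proj e N x - x) < \<epsilon>" by blast
qed

text \<open>On a finite block of modes N+1, ..., M this is the Pythagorean identity together with
  monotonicity of the eigenvalues; then M tends to infinity.\<close>

lemma norm_P_tail_le:
  assumes t: "0 \<le> t"
  shows "norm (P t (z - galerkin_proj e N z)) \<le> exp (- (lam (Suc N) * t)) * norm z"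
proof -
  let ?r = "exp (- (lam (Suc N) * t))"
  have "norm (P t (galerkin_proj e M z - galerkin_proj e N z)) \<le> ?r * norm z" if M: "M \<ge> N" for M
  proof -
    define S where "S = {Suc N..M}"
    have S: "finite S" "S \<subseteq> {1..}" by (auto simp: S_def)
    have "{1..M} = {1..N} \<union> S" using M by (auto simp: S_def)
    then have v: "galerkin_proj e M z - galerkin_proj e N z = (\<Sum>k\<in>S. (z \<bullet> e k) *\<^sub>R e k)"
      unfolding galerkin_proj_eq by (simp add: S_def sum.union_disjoint)
    have "(norm (P t (galerkin_proj e M z - galerkin_proj e N z)))\<^sup>2 = (\<Sum>k\<in>S. (exp (- (lam k * t)) * (z \<bullet> e k))\<^sup>2)"
      unfolding v P_sum_e[OF S(2) t] norm_sum_e[OF S] ..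
    also have "\<dots> \<le> (\<Sum>k\<in>S. ?r\<^sup>2 * (z \<bullet> e k)\<^sup>2)"
    proof (rule sum_mono)
      fix k assume "k \<in> S"
      then have "lam (Suc N) \<le> lam k"
        by (intro mono_onD[OF lam_mono]) (auto simp: S_def)
      then have "exp (- (lam k * t)) \<le> ?r" using t by (simp add: mult_right_mono)
      then show "(exp (- (lam k * t)) * (z \<bullet> e k))\<^sup>2 \<le> ?r\<^sup>2 * (z \<bullet> e k)\<^sup>2"
        unfolding power_mult_distrib by (intro mult_right_mono power_mono) auto
    qed
    \<comment> \<open>Adding the nonnegative terms of the first \<open>N\<close> modes completes the
      sum to the squared norm of a projection, which is at most that of \<open>z\<close>.\<close>
    also have "\<dots> \<le> (\<Sum>k=1..M. ?r\<^sup>2 * (z \<bullet> e k)\<^sup>2)"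
      by (rule sum_mono2) (auto simp: S_def)
    also have "\<dots> = ?r\<^sup>2 * (norm (galerkin_proj e M z))\<^sup>2"
      unfolding galerkin_proj_eq by (subst norm_sum_e) (auto simp: sum_distrib_left)
    also have "\<dots> \<le> ?r\<^sup>2 * (norm z)\<^sup>2"
      by (intro mult_left_mono power_mono norm_galerkin_proj_le) auto
    finally have "(norm (P t (galerkin_proj e M z - galerkin_proj e N z)))\<^sup>2 \<le> (?r * norm z)\<^sup>2"
      by (simp add: power_mult_distrib)
    then show ?thesis by (rule power2_le_imp_le) simp
  qed
  moreover have "(\<lambda>M. norm (P t (galerkin_proj e M z - galerkin_proj e N z))) \<longlonglongrightarrow> norm (P t (z - galerkin_proj e N z))"
    by (intro tendsto_norm bounded_linear.tendsto[OF bounded_linear_P[OF t]] tendsto_diff galerkin_proj_tendsto tendsto_const)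
  ultimately show ?thesis
    by (intro LIMSEQ_le_const2) auto
qed

text \<open>Near s = t the tail bound gives no decay, but its time integral is at most 1/lambda for
  every t. Smallness thus follows from a mere bound on \<open>h\<close>, which makes it uniform in
  the time and in the control.\<close>

lemma norm_convol_tail_le:
  assumes \<lambda>: "0 < lam (Suc N)" and t: "0 \<le> t"
    and h: "integrable (lebesgue_on {0..t}) (\<lambda>s. P (t - s) (h s - galerkin_proj e N (h s)))"
    and M: "AE s in lebesgue_on {0..t}. norm (h s) \<le> M" and M0: "0 \<le> M"
  shows "norm (convol (\<lambda>s. h s - galerkin_proj e N (h s)) t) \<le> M / lam (Suc N)"
proof -
  let ?l = "lam (Suc N)"
  have "norm (convol (\<lambda>s. h s - galerkin_proj e N (h s)) t)
      \<le> (LINT s|lebesgue_on {0..t}. norm (P (t - s) (h s - galerkin_proj e N (h s))))"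
    unfolding convol_def by (rule integral_norm_bound)
  also have "\<dots> \<le> (LINT s|lebesgue_on {0..t}. M * exp (- (?l * t)) * exp (?l * s))"
  proof (rule integral_mono_AE)
    show "integrable (lebesgue_on {0..t}) (\<lambda>s. M * exp (- (?l * t)) * exp (?l * s))"
      by (intro integrable_continuous_on_Icc continuous_intros)
    show "AE s in lebesgue_on {0..t}. norm (P (t - s) (h s - galerkin_proj e N (h s)))
        \<le> M * exp (- (?l * t)) * exp (?l * s)"
      using M AE_space
    proof eventually_elim
      case (elim s)
      then have "norm (P (t - s) (h s - galerkin_proj e N (h s))) \<le> exp (- (?l * (t - s))) * norm (h s)"
        by (intro norm_P_tail_le) auto
      also have "\<dots> \<le> exp (- (?l * (t - s))) * M"
        using elim by (intro mult_left_mono) auto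
      also have "\<dots> = M * exp (- (?l * t)) * exp (?l * s)"
        by (simp add: algebra_simps flip: exp_add)
      finally show ?case .
    qed
  qed (use h in auto)
  also have "\<dots> = M * exp (- (?l * t)) * (LINT s|lebesgue_on {0..t}. exp (?l * s))"
    by simp
  also have "\<dots> \<le> M * exp (- (?l * t)) * (exp (?l * t) / ?l)"
    using M0 \<lambda> t by (intro mult_left_mono integral_exp_Icc_le) auto
  also have "\<dots> = M / ?l" by (simp add: exp_minus)
  finally show ?thesis .
qed

text \<open>\<open>A\<close> is diagonal on the first \<open>N\<close> modes, so its powers are
  explicit and the operator exponential splits into \<open>N\<close> scalar exponential
  series.\<close>

lemma exp_op_galerkin_proj:
  assumes A: "\<And>v. A v = (\<Sum>k=1..N. (v \<bullet> e k) *\<^sub>R (- lam k *\<^sub>R e k))" and t: "0 \<le> t"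
  shows "exp_op A t (galerkin_proj e N x) = P t (galerkin_proj e N x)"
proof -
  have pow: "(A ^^ j) (galerkin_proj e N x) = (\<Sum>k=1..N. ((- lam k) ^ j * (x \<bullet> e k)) *\<^sub>R e k)" for j
  proof (induction j)
    case 0
    then show ?case by (simp add: galerkin_proj_eq)
  next
    case (Suc j)
    have "(A ^^ Suc j) (galerkin_proj e N x) = A (\<Sum>k=1..N. ((- lam k) ^ j * (x \<bullet> e k)) *\<^sub>R e k)"
      by (simp only: funpow.simps comp_def Suc)
    also have "\<dots> = (\<Sum>k=1..N. ((- lam k) ^ Suc j * (x \<bullet> e k)) *\<^sub>R e k)"
      by (subst A, intro sum.cong refl, subst inner_sum_e) auto
    finally show ?case .
  qed
  have "(\<lambda>j. \<Sum>k=1..N. ((- (lam k * t)) ^ j /\<^sub>R fact j) *\<^sub>R ((x \<bullet> e k) *\<^sub>R e k))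
      sums (\<Sum>k=1..N. exp (- (lam k * t)) *\<^sub>R ((x \<bullet> e k) *\<^sub>R e k))"
    by (intro sums_sum sums_scaleR_left exp_converges)
  moreover have "(\<Sum>k=1..N. ((- (lam k * t)) ^ j /\<^sub>R fact j) *\<^sub>R ((x \<bullet> e k) *\<^sub>R e k))
      = (t ^ j / fact j) *\<^sub>R (A ^^ j) (galerkin_proj e N x)" for j
    unfolding pow scaleR_sum_right
    by (intro sum.cong refl) (simp add: power_mult_distrib divide_inverse ac_simps flip: power_mult_distrib)
  ultimately have "exp_op A t (galerkin_proj e N x) = (\<Sum>k=1..N. exp (- (lam k * t)) *\<^sub>R ((x \<bullet> e k) *\<^sub>R e k))"
    unfolding exp_op_def by (simp add: sums_iff)
  also have "\<dots> = P t (galerkin_proj e N x)"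
    unfolding galerkin_proj_eq using t by (subst P_sum_e) auto
  finally show ?thesis .
qed

end

section \<open>Galerkin approximation\<close>

context spectral_semigroup
begin

text \<open>The projector is linear with norm at most 1, so projecting the data preserves
  \<open>K\<close> and \<open>B\<close>; the constants in the estimates are therefore independent of
  \<open>N\<close>.\<close>

lemma mild_problem_galerkin:
  assumes "mild_problem P F K g B T"
  shows "mild_problem P (galerkin_proj e N \<circ> F) K (\<lambda>s. galerkin_proj e N (g s)) B T"
proof -
  interpret mild_problem P F K g B T by fact
  show ?thesis
  proof
    show "K-lipschitz_on UNIV (galerkin_proj e N \<circ> F)"
    proof (rule lipschitz_onI[OF _ K_nonneg])
      fix y z
      have "galerkin_proj e N (F y) - galerkin_proj e N (F z) = galerkin_proj e N (F y - F z)"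
        by (simp add: linear_diff[OF bounded_linear.linear[OF bounded_linear_galerkin_proj]])
      then have "norm (galerkin_proj e N (F y) - galerkin_proj e N (F z)) \<le> norm (F y - F z)"
        using norm_galerkin_proj_le by metis
      also have "\<dots> \<le> K * norm (y - z)" by (rule norm_F_diff_le)
      finally show "dist ((galerkin_proj e N \<circ> F) y) ((galerkin_proj e N \<circ> F) z) \<le> K * dist y z"
        by (simp add: dist_norm)
    qed
    show "(\<lambda>s. galerkin_proj e N (g s)) \<in> borel_measurable (lebesgue_on {0..T})"
      using g_measurable bounded_linear.continuous_on[OF bounded_linear_galerkin_proj continuous_on_id]
      by (rule borel_measurable_continuous_on[rotated])
    show "AE s in lebesgue_on {0..T}. norm (galerkin_proj e N (g s)) \<le> B"
      using g_bounded by eventually_elim (rule order_trans[OF norm_galerkin_proj_le])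
  qed (rule T_nonneg B_nonneg)+
qed

text \<open>The unresolved part is measured along the exact solution: the bound \<open>M\<close>
  concerns \<open>F\<close> along \<open>y\<close>, whereas \<open>F\<close> along the Galerkin
  solution enters only through the Lipschitz difference.\<close>

lemma galerkin_error_le:
  assumes "mild_problem P F K g B T"
    and y: "mild_problem.solves P F g T x y"
    and y\<^sub>N: "mild_problem.solves P (galerkin_proj e N \<circ> F) (\<lambda>s. galerkin_proj e N (g s)) T (galerkin_proj e N x) y\<^sub>N"
    and lam: "0 < lam (Suc N)"
    and M: "\<And>s. s \<in> {0..T} \<Longrightarrow> norm (F (y s)) \<le> M" "0 \<le> M"
    and t: "t \<in> {0..T}"
  shows "norm (y\<^sub>N t - y t)
    \<le> 2 * (norm (x - galerkin_proj e N x) + (M + B) / lam (Suc N)) * exp ((2 * K + 1) * T)"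
proof -
  let ?\<Pi> = "galerkin_proj e N"
  interpret mild_problem P F K g B T by fact
  interpret N: mild_problem P "?\<Pi> \<circ> F" K "\<lambda>s. ?\<Pi> (g s)" B T
    by (rule mild_problem_galerkin) fact
  have cy: "continuous_on {0..T} y" and cN: "continuous_on {0..T} y\<^sub>N"
    using y y\<^sub>N by (auto simp: solves_def N.solves_def)
  show ?thesis
  proof (rule weighted_gronwall[OF T_nonneg K_nonneg _ _ _ _ t, of "\<lambda>t. norm (y\<^sub>N t - y t)"])
    show "continuous_on {0..T} (\<lambda>t. norm (y\<^sub>N t - y t))" by (intro continuous_intros cy cN)
    show "0 \<le> norm (x - ?\<Pi> x) + (M + B) / lam (Suc N)" using M(2) B_nonneg lam by simp
    fix t assume t: "t \<in> {0..T}"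
    then have t': "0 \<le> t" "t \<le> T" by auto
    let ?Fy = "\<lambda>s. F (y s)"
    note intF = integrable_orbit_continuous[OF continuous_on_F[OF cy] t'(2)]
    note int\<Pi>F = integrable_orbit_continuous[OF N.continuous_on_F[OF cy] t'(2), unfolded comp_def]
    note intg = integrable_orbit[OF g_measurable g_bounded t'(2)]
    note int\<Pi>g = integrable_orbit[OF N.g_measurable N.g_bounded t'(2)]
    have 1: "norm (P t (x - ?\<Pi> x)) \<le> norm (x - ?\<Pi> x)" using t' by (intro norm_P_le)
    have 2: "norm (convol (\<lambda>s. (?\<Pi> \<circ> F) (y\<^sub>N s)) t - convol (\<lambda>s. (?\<Pi> \<circ> F) (y s)) t)
        \<le> K * (LINT s|lebesgue_on {0..t}. norm (y\<^sub>N s - y s))"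
      by (rule N.norm_convol_F_diff_le[OF cN cy t])
    have 3: "norm (convol (\<lambda>s. ?Fy s - ?\<Pi> (?Fy s)) t) \<le> M / lam (Suc N)"
      using t' M by (intro norm_convol_tail_le lam convol_diff(2) intF int\<Pi>F) (auto intro!: AE_I2)
    have 4: "norm (convol (\<lambda>s. g s - ?\<Pi> (g s)) t) \<le> B / lam (Suc N)"
      using t' by (intro norm_convol_tail_le lam convol_diff(2) intg int\<Pi>g
          AE_lebesgue_on_Icc_mono[OF g_bounded] B_nonneg) auto
    have y_eq: "y t = P t x + convol ?Fy t + convol g t"
      using y t by (simp add: solves_def)
    have y\<^sub>N_eq: "y\<^sub>N t = P t (?\<Pi> x) + convol (\<lambda>s. (?\<Pi> \<circ> F) (y\<^sub>N s)) t + convol (\<lambda>s. ?\<Pi> (g s)) t"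
      using y\<^sub>N t by (simp add: N.solves_def)
    \<comment> \<open>The projected nonlinearity along \<open>y\<close> is inserted. The first
      difference feeds Gronwall, and each remaining term involves only components in the kernel of
      the projector.\<close>
    have "y\<^sub>N t - y t = (convol (\<lambda>s. (?\<Pi> \<circ> F) (y\<^sub>N s)) t - convol (\<lambda>s. (?\<Pi> \<circ> F) (y s)) t)
        - (P t (x - ?\<Pi> x) + convol (\<lambda>s. ?Fy s - ?\<Pi> (?Fy s)) t + convol (\<lambda>s. g s - ?\<Pi> (g s)) t)"
      unfolding y_eq y\<^sub>N_eq using t'
      by (simp add: P_diff comp_def
          convol_diff(1)[OF intF int\<Pi>F, symmetric] convol_diff(1)[OF intg int\<Pi>g, symmetric])
    then have "norm (y\<^sub>N t - y t)
        \<le> norm (convol (\<lambda>s. (?\<Pi> \<circ> F) (y\<^sub>N s)) t - convol (\<lambda>s. (?\<Pi> \<circ> F) (y s)) t)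
          + (norm (P t (x - ?\<Pi> x)) + norm (convol (\<lambda>s. ?Fy s - ?\<Pi> (?Fy s)) t)
          + norm (convol (\<lambda>s. g s - ?\<Pi> (g s)) t))"
      by (simp only: order_trans[OF norm_triangle_ineq4 add_left_mono[OF order_trans[OF norm_triangle_ineq
          add_right_mono[OF norm_triangle_ineq]]]])
    also have "\<dots> \<le> K * (LINT s|lebesgue_on {0..t}. norm (y\<^sub>N s - y s))
        + (norm (x - ?\<Pi> x) + M / lam (Suc N) + B / lam (Suc N))"
      by (intro add_mono 1 2 3 4)
    finally show "norm (y\<^sub>N t - y t) \<le> norm (x - ?\<Pi> x) + (M + B) / lam (Suc N)
        + K * (LINT s|lebesgue_on {0..t}. norm (y\<^sub>N s - y s))"
      by (simp add: add_divide_distrib)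
  qed simp
qed

text \<open>The fixed point argument runs in the whole space. Its solution stays in the Galerkin
  space because the semigroup preserves that space and the bounded projector commutes with the
  integrals.\<close>

lemma galerkin_solution_in_space:
  assumes "voc_solution P (galerkin_proj e N \<circ> F) (galerkin_proj e N \<circ> C) T UNIV (galerkin_proj e N x) u y"
    and t: "t \<in> {0..T}"
  shows "y t \<in> galerkin_space e N"
proof -
  let ?\<Pi> = "galerkin_proj e N"
  interpret bounded_linear ?\<Pi> by (rule bounded_linear_galerkin_proj)
  have \<Pi>P: "?\<Pi> (P r (?\<Pi> z)) = P r (?\<Pi> z)" if "0 \<le> r" for r z
  proof -
    have "P r (?\<Pi> z) = (\<Sum>k=1..N. (exp (- (lam k * r)) * (z \<bullet> e k)) *\<^sub>R e k)"
      unfolding galerkin_proj_eq using that by (intro P_sum_e) auto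
    then show ?thesis by (simp only: galerkin_proj_sum_e)
  qed
  have int: "?\<Pi> (LINT s|lebesgue_on {0..t}. P (t - s) (?\<Pi> (h s))) = (LINT s|lebesgue_on {0..t}. P (t - s) (?\<Pi> (h s)))"
    if "integrable (lebesgue_on {0..t}) (\<lambda>s. P (t - s) (?\<Pi> (h s)))" for h
    unfolding integral_bounded_linear[OF bounded_linear_galerkin_proj that, symmetric]
    by (intro Bochner_Integration.integral_cong refl) (simp add: \<Pi>P)
  have "?\<Pi> (y t) = y t"
    using assms unfolding voc_solution_def comp_def by (simp add: add int \<Pi>P)
  then show ?thesis using galerkin_proj_in_space by metis
qed

text \<open>All data are projected, so in the formula \<open>S\<close> and \<open>P\<close> act only
  on the range of the projector and at times t - s \<ge> 0, where they agree.\<close>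

lemma voc_solution_galerkin_iff:
  assumes S: "\<And>t z. 0 \<le> t \<Longrightarrow> S t (galerkin_proj e N z) = P t (galerkin_proj e N z)"
  shows "voc_solution S (galerkin_proj e N \<circ> F) (galerkin_proj e N \<circ> C) T (galerkin_space e N) (galerkin_proj e N x) u y
    \<longleftrightarrow> voc_solution P (galerkin_proj e N \<circ> F) (galerkin_proj e N \<circ> C) T UNIV (galerkin_proj e N x) u y"
    (is "?L \<longleftrightarrow> ?R")
proof -
  let ?\<Pi> = "galerkin_proj e N"
  have "integrable (lebesgue_on {0..t}) (\<lambda>s. S (t - s) (?\<Pi> (h s)))
        \<longleftrightarrow> integrable (lebesgue_on {0..t}) (\<lambda>s. P (t - s) (?\<Pi> (h s)))"
    and "(LINT s|lebesgue_on {0..t}. S (t - s) (?\<Pi> (h s))) = (LINT s|lebesgue_on {0..t}. P (t - s) (?\<Pi> (h s)))"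
    for h and t :: real
    by (auto intro!: Bochner_Integration.integrable_cong Bochner_Integration.integral_cong simp: S)
  then have "voc_solution S (?\<Pi> \<circ> F) (?\<Pi> \<circ> C) T Y (?\<Pi> x) u y \<longleftrightarrow> voc_solution P (?\<Pi> \<circ> F) (?\<Pi> \<circ> C) T Y (?\<Pi> x) u y" for Y
    unfolding voc_solution_def by (auto simp: S)
  moreover have "?R \<Longrightarrow> voc_solution P (?\<Pi> \<circ> F) (?\<Pi> \<circ> C) T (galerkin_space e N) (?\<Pi> x) u y"
    using galerkin_solution_in_space[of N F C T x u y] unfolding voc_solution_def C_paths_def by auto
  moreover have "voc_solution P (?\<Pi> \<circ> F) (?\<Pi> \<circ> C) T (galerkin_space e N) (?\<Pi> x) u y \<Longrightarrow> ?R"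
    unfolding voc_solution_def C_paths_def by auto
  ultimately show ?thesis by blast
qed

end

section \<open>Specialisation to the Laplace-Beltrami operator on the sphere\<close>

lemma laplace_spectral_semigroup:
  assumes e: "laplace_eigenbasis lam e" and P: "contraction_semigroup P"
    and gen: "generates laplace_domain laplace_beltrami P"
  shows "spectral_semigroup P e lam"
proof -
  interpret contraction_sg P by unfold_locales (rule P)
  show ?thesis
  proof
    fix k :: nat and t :: real assume k: "1 \<le> k" and t: "0 \<le> t"
    from e k have ek: "e k \<in> laplace_domain" "- laplace_beltrami (e k) = lam k *\<^sub>R e k" "0 \<le> lam k"
      by (auto simp: laplace_eigenbasis_def)
    have "((\<lambda>h. (P h (e k) - e k) /\<^sub>R h) \<longlongrightarrow> laplace_beltrami (e k)) (at_right 0)"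
      using gen ek(1) unfolding generates_def by blast
    also have "laplace_beltrami (e k) = - (lam k *\<^sub>R e k)"
      using ek(2) by (metis minus_minus)
    finally show "P t (e k) = exp (- (lam k * t)) *\<^sub>R e k"
      using ek(3) t by (rule P_eigenvector)
  qed (use e in \<open>auto simp: laplace_eigenbasis_def\<close>)
qed

text \<open>The Laplacian of a finite eigenfunction sum stays in the Galerkin space, so the outer
  projector acts as the identity and the compressed Laplacian is diagonal.\<close>

lemma exp_op_galerkin_laplacian:
  assumes e: "laplace_eigenbasis lam e" and P: "contraction_semigroup P"
    and gen: "generates laplace_domain laplace_beltrami P" and t: "0 \<le> t"
  shows "exp_op (galerkin_laplacian e N) t (galerkin_proj e N z) = P t (galerkin_proj e N z)"
proof -
  interpret spectral_semigroup P e lam by (rule laplace_spectral_semigroup[OF e P gen])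
  show ?thesis
  proof (rule exp_op_galerkin_proj[OF _ t])
    fix v
    have ek: "e k \<in> laplace_domain" "laplace_beltrami (e k) = - lam k *\<^sub>R e k" if "k \<in> {1..N}" for k
    proof -
      have "e k \<in> laplace_domain \<and> - laplace_beltrami (e k) = lam k *\<^sub>R e k"
        using e that by (simp add: laplace_eigenbasis_def)
      then show "e k \<in> laplace_domain" "laplace_beltrami (e k) = - lam k *\<^sub>R e k"
        by (auto simp: minus_equation_iff[of "laplace_beltrami _"] scaleR_minus_left)
    qed
    have "laplace_beltrami (galerkin_proj e N v) = (\<Sum>k=1..N. (v \<bullet> e k) *\<^sub>R laplace_beltrami (e k))"
      unfolding galerkin_proj_eq using ek(1) by (rule generator_sum[OF gen])
    also have "\<dots> = (\<Sum>k=1..N. (- lam k * (v \<bullet> e k)) *\<^sub>R e k)"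
      using ek(2) by (intro sum.cong refl) (simp add: mult.commute)
    finally show "galerkin_laplacian e N v = (\<Sum>k=1..N. (v \<bullet> e k) *\<^sub>R (- lam k *\<^sub>R e k))"
      unfolding galerkin_laplacian_def comp_def
      by (simp only: galerkin_proj_sum_e) (simp add: mult.commute)
  qed
qed

theorem corollary3p1:
  fixes n :: nat
    and lam :: "nat \<Rightarrow> real" and e :: "nat \<Rightarrow> 'a::euclidean_space sphere_L2"
    and P :: "real \<Rightarrow> 'a sphere_L2 \<Rightarrow> 'a sphere_L2"
    and F :: "'a sphere_L2 \<Rightarrow> 'a sphere_L2"
    and C :: "'v::{real_inner, complete_space} \<Rightarrow> 'a sphere_L2"
    and U :: "'v set" and q :: real
  assumes "1 \<le> n" and "DIM('a) = n + 1"
    and "laplace_eigenbasis lam e"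
    and "contraction_semigroup P" and "generates laplace_domain laplace_beltrami P"
    and "\<exists>K. K-lipschitz_on UNIV F"
    and "\<exists>K. K-lipschitz_on UNIV C" and "C 0 = 0"
    and "compact U" and "1 < q"
  shows "(\<forall>T>0. \<forall>x. \<forall>u\<in>admissible_controls U q T.
            (\<exists>!y. is_mild_solution P F C T x u y) \<and>
            (\<forall>N\<ge>1. \<exists>!y. is_galerkin_solution e N F C T x u y))
       \<and> (\<forall>T>0. \<forall>x.
            (\<lambda>N. SUP u\<in>admissible_controls U q T. SUP t\<in>{0..T}.
                   ennreal (norm (galerkin_solution e N F C T x u t - mild_solution P F C T x u t)))
              \<longlonglongrightarrow> 0)"
proof -
  interpret spectral_semigroup P e lam
    by (rule laplace_spectral_semigroup[OF assms(3-5)])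
  obtain K where K: "K-lipschitz_on UNIV F" using assms(6) by blast
  have C: "continuous_on UNIV C" using assms(7) lipschitz_on_continuous_on by blast
  \<comment> \<open>Compactness of \<open>U\<close> yields one bound on the forcing for all
    admissible controls: the origin of the uniformity in \<open>u\<close>.\<close>
  obtain B where B: "0 < B" "\<And>v. v \<in> U \<Longrightarrow> norm (C v) \<le> B"
    using compact_imp_bounded[OF compact_continuous_image[OF continuous_on_subset[OF C] assms(9)]]
    by (auto simp: bounded_pos)
  have mild: "mild_problem P F K (\<lambda>s. C (u s)) B T" if "0 < T" and u: "u \<in> admissible_controls U q T" for T u
  proof
    show "(\<lambda>s. C (u s)) \<in> borel_measurable (lebesgue_on {0..T})"
      using u C by (intro borel_measurable_strongly_measurable_comp)
        (auto simp: admissible_controls_def Lq_fun_def)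
    have "AE s in lebesgue_on {0..T}. u s \<in> U" using u by (simp add: admissible_controls_def)
    then show "AE s in lebesgue_on {0..T}. norm (C (u s)) \<le> B"
      by eventually_elim (rule B)
  qed (use K B that in auto)
  have mild_iff: "is_mild_solution P F C T x u y \<longleftrightarrow>
      y \<in> extensional {0..T} \<and> mild_problem.solves P F (\<lambda>s. C (u s)) T x y"
    if "0 < T" "u \<in> admissible_controls U q T" for T x u y
    by (rule mild_problem.voc_solution_iff_solves[OF mild[OF that], where C = C and u = u, OF refl])
  have galerkin_iff: "is_galerkin_solution e N F C T x u y \<longleftrightarrow> y \<in> extensional {0..T} \<and>
      mild_problem.solves P (galerkin_proj e N \<circ> F) (\<lambda>s. galerkin_proj e N (C (u s))) T (galerkin_proj e N x) y"
    if "0 < T" "u \<in> admissible_controls U q T" for N T x u y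
  proof -
    have "is_galerkin_solution e N F C T x u y \<longleftrightarrow>
        voc_solution P (galerkin_proj e N \<circ> F) (galerkin_proj e N \<circ> C) T UNIV (galerkin_proj e N x) u y"
      unfolding is_galerkin_solution_def
      by (intro voc_solution_galerkin_iff exp_op_galerkin_laplacian[OF assms(3-5)])
    also have "\<dots> \<longleftrightarrow> y \<in> extensional {0..T} \<and>
      mild_problem.solves P (galerkin_proj e N \<circ> F) (\<lambda>s. galerkin_proj e N (C (u s))) T (galerkin_proj e N x) y"
      by (rule mild_problem.voc_solution_iff_solves[OF mild_problem_galerkin[OF mild[OF that]]]) (simp add: comp_def)
    finally show ?thesis .
  qed
  have mild_ex1: "\<exists>!y. is_mild_solution P F C T x u y"
    if "0 < T" "u \<in> admissible_controls U q T" for T x u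
    unfolding mild_iff[OF that] by (rule mild_problem.ex1_solves[OF mild[OF that]])
  have galerkin_ex1: "\<exists>!y. is_galerkin_solution e N F C T x u y"
    if "0 < T" "u \<in> admissible_controls U q T" for N T x u
    unfolding galerkin_iff[OF that] by (rule mild_problem.ex1_solves[OF mild_problem_galerkin[OF mild[OF that]]])
  have "(\<lambda>N. SUP u\<in>admissible_controls U q T. SUP t\<in>{0..T}.
      ennreal (norm (galerkin_solution e N F C T x u t - mild_solution P F C T x u t))) \<longlonglongrightarrow> 0"
    (is "?err \<longlonglongrightarrow> 0") if T: "0 < T" for T x
  proof -
    \<comment> \<open>Linear growth of \<open>F\<close> applied to the a priori bound of
      \<open>solves_bound\<close>; the result depends on neither the control nor
      \<open>N\<close>.\<close>
    define M where "M = norm (F 0) + K * (2 * (norm x + (norm (F 0) + B) * T) * exp ((2 * K + 1) * T))"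
    define b where "b N = 2 * (norm (x - galerkin_proj e N x) + (M + B) / lam (Suc N)) * exp ((2 * K + 1) * T)" for N
    have "0 \<le> M" unfolding M_def using lipschitz_on_nonneg[OF K] B T by simp
    have lam: "filterlim (\<lambda>N. lam (Suc N)) at_top sequentially"
      using assms(3) by (auto simp: laplace_eigenbasis_def filterlim_sequentially_Suc)
    have "b \<longlonglongrightarrow> 2 * (norm (x - x) + 0) * exp ((2 * K + 1) * T)"
      unfolding b_def by (intro tendsto_intros galerkin_proj_tendsto real_tendsto_divide_at_top[OF tendsto_const lam])
    then have "(\<lambda>N. ennreal (b N)) \<longlonglongrightarrow> 0"
      by (auto dest: tendsto_ennrealI)
    \<comment> \<open>Eigenvalues are only known to be nonnegative, so division by them is
      restricted to large \<open>N\<close>.\<close>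
    moreover have "eventually (\<lambda>N. 0 < lam (Suc N)) sequentially"
      using lam by (simp add: filterlim_at_top_dense)
    then have "eventually (\<lambda>N. ?err N \<le> ennreal (b N)) sequentially"
    proof eventually_elim
      case (elim N)
      \<comment> \<open>Suprema in \<open>ennreal\<close> always exist, so a bound for each
        \<open>u\<close> and \<open>t\<close> suffices.\<close>
      show ?case
      proof (intro SUP_least ennreal_leI)
        fix u t assume u: "u \<in> admissible_controls U q T" and t: "t \<in> {0..T}"
        interpret mild_problem P F K "\<lambda>s. C (u s)" B T by (rule mild[OF T u])
        have y: "solves x (mild_solution P F C T x u)"
          using theI'[OF mild_ex1[OF T u]] unfolding mild_solution_def mild_iff[OF T u] by blast
        have "norm (F (mild_solution P F C T x u s)) \<le> M" if "s \<in> {0..T}" for s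
        proof -
          have "norm (F (mild_solution P F C T x u s)) \<le> norm (F 0) + K * norm (mild_solution P F C T x u s)"
            using norm_F_diff_le[of _ 0] norm_triangle_sub[of "F (mild_solution P F C T x u s)" "F 0"]
            by (smt (verit) diff_zero)
          also have "\<dots> \<le> M"
            unfolding M_def using K_nonneg solves_bound[OF y that] by (intro add_mono mult_left_mono) auto
          finally show ?thesis .
        qed
        moreover have "mild_problem.solves P (galerkin_proj e N \<circ> F) (\<lambda>s. galerkin_proj e N (C (u s))) T
            (galerkin_proj e N x) (galerkin_solution e N F C T x u)"
          using theI'[OF galerkin_ex1[OF T u]] unfolding galerkin_solution_def galerkin_iff[OF T u] by blast
        ultimately show "norm (galerkin_solution e N F C T x u t - mild_solution P F C T x u t) \<le> b N"
          unfolding b_def using mild[OF T u] y elim \<open>0 \<le> M\<close> t by (intro galerkin_error_le) auto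
      qed
    qed
    ultimately show ?thesis
      by (intro tendsto_sandwich[of "\<lambda>_. 0" ?err sequentially "\<lambda>N. ennreal (b N)"]) auto
  qed
  with mild_ex1 galerkin_ex1 show ?thesis by blast
qed

end
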